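(* Let $0<\alpha<2$ and $\delta=\delta(\alpha)=\min\{1/4,(3C)^{-1/(1+\alpha)}\}$ with $C=2^{\alpha+1}(1+2\alpha)$. Let $\rho$ be a classical solution on $\mathbb{T}\times[0,\infty)$ of $\partial_t\rho+\partial_x(\rho u)=0$, $u=H\Lambda^{\alpha-1}\rho$, with smooth $1$-periodic initial datum $\rho_0$ satisfying (H1), (H2), (H3), and let $m=\int_{\mathbb{T}}\rho_0(x)\,dx>0$. Then there is a constant $A=A(\alpha,m,\rho_{\max})>0$ such that for every $(x,t)$ with $x\in[0,\delta]$, $t\ge0$ and $\rho(x,t)\le m/2$, one has $$u(x,t)\le -A\,x.$$
   Context: $\mathbb{T}=\mathbb{R}/\mathbb{Z}$ identified with $[-1/2,1/2)$; functions on $\mathbb{T}$ are identified with their $1$-periodic extensions. $u(x,t)=c_\alpha\,\mathrm{P.V.}\int_{\mathbb{R}}\frac{\rho(y,t)-\rho(x,t)}{\mathrm{sgn}(x-y)|x-y|^{\alpha}}dy$ with $c_\alpha>0$ the constant for which $\Lambda^\alpha f(x)=c_\alpha\,\mathrm{P.V.}\int_{\mathbb{R}}\frac{f(x)-f(y)}{|x-y|^{1+\alpha}}dy$. (H1) $\rho_0(x)=\rho_0(-x)$; (H2) $0\le\rho_0\le\rho_{\max}$ for a constant $\rho_{\max}>0$; (H3) $\rho_0(0)=0$ and $\partial_x\rho_0\ge0$ on $[0,1/2]$. *)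

theory Defs
  imports "HOL-Analysis.Analysis"
begin

text \<open>Normalising constant of the fractional Laplacian on the line:
  Lambda^alpha f(x) = c_alpha P.V. int (f x - f y)/|x-y|^(1+alpha) dy, symbol |xi|^alpha.\<close>
definition c_alpha :: "real \<Rightarrow> real" where
  "c_alpha a = a * 2 powr (a - 1) * Gamma ((1 + a) / 2) / (sqrt pi * Gamma (1 - a / 2))"

definition C_const :: "real \<Rightarrow> real" where
  "C_const a = 2 powr (a + 1) * (1 + 2 * a)"

definition delta_const :: "real \<Rightarrow> real" where
  "delta_const a = min (1/4) ((3 * C_const a) powr (- 1 / (1 + a)))"

definition smooth_real :: "(real \<Rightarrow> real) \<Rightarrow> bool" where
  "smooth_real f \<longleftrightarrow> (\<forall>n x. ((deriv ^^ n) f) differentiable (at x))"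

definition admissible_datum :: "real \<Rightarrow> (real \<Rightarrow> real) \<Rightarrow> bool" where
  "admissible_datum rmax rho0 \<longleftrightarrow>
     smooth_real rho0 \<and> (\<forall>x. rho0 (x + 1) = rho0 x) \<and>
     (\<forall>x. rho0 x = rho0 (- x)) \<and>
     (\<forall>x. 0 \<le> rho0 x \<and> rho0 x \<le> rmax) \<and>
     rho0 0 = 0 \<and> (\<forall>x\<in>{0..1/2}. deriv rho0 x \<ge> 0)"

definition pv_velocity ::
    "real \<Rightarrow> (real \<Rightarrow> real \<Rightarrow> real) \<Rightarrow> real \<Rightarrow> real \<Rightarrow> real \<Rightarrow> bool" where
  "pv_velocity a rho x t v \<longleftrightarrow>
     ((\<lambda>(e, R). c_alpha a * integral {y. e < \<bar>x - y\<bar> \<and> \<bar>x - y\<bar> < R}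
         (\<lambda>y. (rho y t - rho x t) / (sgn (x - y) * \<bar>x - y\<bar> powr a)))
      \<longlongrightarrow> v) (at_right 0 \<times>\<^sub>F at_top)"

definition classical_solution ::
    "real \<Rightarrow> (real \<Rightarrow> real) \<Rightarrow> (real \<Rightarrow> real \<Rightarrow> real) \<Rightarrow> (real \<Rightarrow> real \<Rightarrow> real) \<Rightarrow> bool" where
  "classical_solution a rho0 rho u \<longleftrightarrow>
     (\<forall>x. rho x 0 = rho0 x) \<and>
     (\<forall>x t. t \<ge> 0 \<longrightarrow> rho (x + 1) t = rho x t) \<and>
     continuous_on (UNIV \<times> {0..}) (\<lambda>(x, t). rho x t) \<and>
     (\<forall>x t. t \<ge> 0 \<longrightarrow> pv_velocity a rho x t (u x t)) \<and>
     (\<forall>x t. t > 0 \<longrightarrow>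
        (\<lambda>s. rho x s) differentiable (at t) \<and>
        (\<lambda>y. rho y t) differentiable (at x) \<and>
        (\<lambda>y. rho y t * u y t) differentiable (at x) \<and>
        deriv (\<lambda>s. rho x s) t + deriv (\<lambda>y. rho y t * u y t) x = 0) \<and>
     continuous_on (UNIV \<times> {0<..}) (\<lambda>(x, t). deriv (\<lambda>s. rho x s) t) \<and>
     continuous_on (UNIV \<times> {0<..}) (\<lambda>(x, t). deriv (\<lambda>y. rho y t) x)"

end

theory Submission
  imports Defs
begin

text \<open>
  Everything is done with the primitive \<open>P(x, t) = \<integral>\<^sub>0\<^sup>x \<rho>(y, t) dy\<close>, which solves
  \<open>P\<^sub>t = (\<rho> u)(0, t) - \<rho> u\<close> with \<open>u\<close> a positive multiple of \<open>\<Lambda>\<^sup>\<alpha> P\<close>.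
  Finite combinations of values of \<open>P\<close> obey a minimum principle: at a minimum over the
  positions all densities involved agree, and one integration by parts in the principal value
  fixes the sign of the corresponding combination of velocities.  For two points this gives
  positivity of \<open>\<rho>\<close>; comparing the solution with its reflection gives evenness, and with its
  translates the bound \<open>\<rho> \<le> m + \<rho>\<^sub>m\<^sub>a\<^sub>x\<close>.  For \<open>P(x + h) + P(x - h) - 2 P(x)\<close>, \<open>x\<close> and \<open>h\<close> in
  \<open>[0, 1/2]\<close>, it gives convexity of \<open>P\<close> on \<open>[0, 1/2]\<close>, that is, \<open>\<rho>\<close> stays increasing there.
  The estimate then follows from
  \<open>u(x) = - c\<^sub>\<alpha> \<alpha> \<integral>\<^sub>0\<^sup>\<infinity> (P(x + z) + P(x - z) - 2 P(x)) z\<^sup>-\<^sup>1\<^sup>-\<^sup>\<alpha> dz\<close>: near \<open>z = 1/2\<close> the second difference is at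
  least a multiple of \<open>x\<close>, because \<open>\<rho> \<le> m/2\<close> on \<open>[-x, x]\<close> while \<open>\<rho> \<ge> 3m/4\<close> on a neighbourhood
  of \<open>1/2\<close> whose size depends on \<open>m\<close> and the upper bound only.
\<close>

subsection \<open>Calculus preliminaries\<close>

lemma antiderivative_exists:
  fixes f :: "real \<Rightarrow> real"
  assumes "continuous_on UNIV f"
  obtains F where "F 0 = 0" "\<And>x. (F has_real_derivative f x) (at x)"
proof -
  \<comment> \<open>An integral over a reversed interval is 0, so at most one term is nonzero and
    the difference is the signed integral from 0 to x.\<close>
  define F where "F x = integral {0..x} f - integral {x..0} f" for x
  have int: "f integrable_on {c..d}" for c d
    using assms continuous_on_subset integrable_continuous_real by blast
  have "(F has_real_derivative f x) (at x)" for x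
  proof -
    define k where "k = \<bar>x\<bar> + 1"
    have F_eq: "F y = integral {-k..y} f - integral {-k..0} f" if "-k \<le> y" for y
    proof (cases "0 \<le> y")
      case True
      have "integral {-k..0} f + integral {0..y} f = integral {-k..y} f"
        using True int by (intro Henstock_Kurzweil_Integration.integral_combine) (auto simp: k_def)
      moreover have "integral {y..0} f = 0"
        using True by (cases "y = 0") auto
      ultimately show ?thesis by (simp add: F_def)
    next
      case False
      have "integral {-k..y} f + integral {y..0} f = integral {-k..0} f"
        using False int that by (intro Henstock_Kurzweil_Integration.integral_combine) auto
      with False show ?thesis by (simp add: F_def)
    qed
    have "((\<lambda>y. integral {-k..y} f) has_real_derivative f x) (at x within {-k..k})"
      using assms continuous_on_subset
      by (intro integral_has_real_derivative) (auto simp: k_def)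
    then have "((\<lambda>y. integral {-k..y} f - integral {-k..0} f) has_real_derivative f x) (at x within {-k<..<k})"
      by (auto intro!: derivative_eq_intros elim: DERIV_subset)
    then have "(F has_real_derivative f x) (at x within {-k<..<k})"
      using F_eq by (subst has_field_derivative_cong_eventually)
        (auto simp: k_def eventually_at_filter)
    then show ?thesis
      by (subst (asm) at_within_open) (auto simp: k_def)
  qed
  moreover have "F 0 = 0" by (simp add: F_def)
  ultimately show thesis using that by blast
qed

lemma periodic_int:
  fixes f :: "real \<Rightarrow> 'b"
  assumes "\<And>x. f (x + 1) = f x"
  shows "f (x + of_int n) = f x"
proof (induction n rule: int_induct[where k = 0])
  case (step1 i)
  then show ?case using assms[of "x + of_int i"] by (simp add: add.assoc)
next
  case (step2 i)
  then show ?case using assms[of "x + of_int (i - 1)"] by simp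
qed simp

lemma periodic_frac:
  fixes f :: "real \<Rightarrow> 'b"
  assumes "\<And>x. f (x + 1) = f x"
  shows "f (frac x) = f x"
  using periodic_int[of f "frac x" "\<lfloor>x\<rfloor>", OF assms] by (simp add: frac_def)

lemma periodic_bounded:
  fixes f :: "real \<Rightarrow> real"
  assumes "\<And>x. f (x + 1) = f x" "continuous_on UNIV f"
  obtains B where "B > 0" "\<And>x. \<bar>f x\<bar> \<le> B"
proof -
  have "bounded (f ` {0..1})"
    using assms(2) continuous_on_subset by (intro compact_imp_bounded compact_continuous_image) auto
  then obtain B where B: "B > 0" "\<And>x. x \<in> {0..1} \<Longrightarrow> \<bar>f x\<bar> \<le> B"
    by (auto simp: bounded_pos)
  have "\<bar>f x\<bar> \<le> B" for x
    using B(2)[of "frac x"] periodic_frac[of f x, OF assms(1)]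
      frac_ge_0[of x] frac_lt_1[of x] by auto
  with B(1) show thesis using that by blast
qed

text \<open>Perturb by \<epsilon> t: at a minimum of \<open>W + \<epsilon> * t\<close> over
  \<open>K\<close> and the time interval with value below \<open>M\<close>, time is positive and the
  position minimises \<open>W\<close> at that time. By \<open>step\<close> the perturbed function
  then has a positive time derivative, so it was smaller just before. The sign is thus needed only
  at global spatial minima below \<open>M\<close>.\<close>

lemma minimum_principle:
  fixes W :: "'p::metric_space \<Rightarrow> real \<Rightarrow> real"
  assumes K: "compact K" and W: "continuous_on (K \<times> {0..}) (\<lambda>(p, t). W p t)"
    and init: "\<And>p. p \<in> K \<Longrightarrow> M \<le> W p 0"
    and step: "\<And>p t. p \<in> K \<Longrightarrow> 0 < t \<Longrightarrow> W p t < M \<Longrightarrow> (\<And>q. q \<in> K \<Longrightarrow> W p t \<le> W q t)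
       \<Longrightarrow> \<exists>d\<ge>0. ((\<lambda>s. W p s) has_real_derivative d) (at t)"
    and "p \<in> K" "0 \<le> t"
  shows "M \<le> W p t"
proof (rule ccontr)
  assume "\<not> M \<le> W p t"
  then have less: "W p t < M" by simp
  then have "0 < t" using init[OF \<open>p \<in> K\<close>] \<open>0 \<le> t\<close> by (cases "t = 0") auto
  \<comment> \<open>Half of the deficit \<open>M - W p t\<close> is spent on the perturbation, which
    keeps the value at \<open>(p, t)\<close> below \<open>M\<close>.\<close>
  define \<epsilon> where "\<epsilon> = (M - W p t) / (2 * t)"
  have "\<epsilon> > 0" using less \<open>0 < t\<close> by (simp add: \<epsilon>_def)
  define V where "V = (\<lambda>(p, t). W p t + \<epsilon> * t)"
  have "continuous_on (K \<times> {0..t}) V"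
    unfolding V_def case_prod_unfold
    by (intro continuous_intros continuous_on_subset[OF W[unfolded case_prod_unfold]]) auto
  moreover have "compact (K \<times> {0..t})" "K \<times> {0..t} \<noteq> {}"
    using K \<open>p \<in> K\<close> \<open>0 \<le> t\<close> by (auto simp: compact_Times)
  ultimately obtain z where z: "z \<in> K \<times> {0..t}" "\<And>y. y \<in> K \<times> {0..t} \<Longrightarrow> V z \<le> V y"
    using continuous_attains_inf[of "K \<times> {0..t}" V] by metis
  obtain p' t' where z_eq: "z = (p', t')" by force
  have p': "p' \<in> K" and t': "0 \<le> t'" "t' \<le> t" using z(1) z_eq by auto
  have "V z \<le> V (p, t)" using z(2)[of "(p, t)"] \<open>p \<in> K\<close> \<open>0 \<le> t\<close> by auto
  also have "\<dots> < M" using less \<open>0 < t\<close> by (simp add: V_def \<epsilon>_def field_simps)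
  finally have Vz: "W p' t' + \<epsilon> * t' < M" by (simp add: V_def z_eq)
  have "t' > 0"
  proof (rule ccontr)
    assume "\<not> t' > 0"
    with t' have "t' = 0" by simp
    with Vz init[OF p'] show False by simp
  qed
  have "W p' t' < M" using Vz \<open>\<epsilon> > 0\<close> \<open>t' > 0\<close> by (smt (verit) mult_pos_pos)
  moreover have "W p' t' \<le> W q t'" if "q \<in> K" for q
    using z(2)[of "(q, t')"] that t' by (simp add: V_def z_eq)
  ultimately obtain d where d: "d \<ge> 0" "((\<lambda>s. W p' s) has_real_derivative d) (at t')"
    using step[OF p' \<open>t' > 0\<close>] by blast
  have "((\<lambda>s. V (p', s)) has_real_derivative d + \<epsilon>) (at t')"
    using d(2) by (auto simp: V_def intro!: derivative_eq_intros)
  moreover have "d + \<epsilon> > 0" using d(1) \<open>\<epsilon> > 0\<close> by simp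
  ultimately obtain r where r: "r > 0" "\<And>h. 0 < h \<Longrightarrow> h < r \<Longrightarrow> V (p', t' - h) < V (p', t')"
    using DERIV_pos_inc_left[of "\<lambda>s. V (p', s)"] by blast
  define h where "h = min (r / 2) t'"
  have h: "0 < h" "h < r" "h \<le> t'" using r(1) \<open>t' > 0\<close> by (auto simp: h_def)
  have "V (p', t') \<le> V (p', t' - h)"
    using z(2)[of "(p', t' - h)"] p' h t' by (auto simp: z_eq)
  with r(2)[of h] h show False by simp
qed

text \<open>Controls boundary terms at the singularity: if \<open>q\<close> is O(z), its successive
  antiderivatives vanishing at 0 gain one power of z each, and against the weights z^(-a), z^(-a-1),
  z^(-a-2) each leaves z^(2-a).\<close>

lemma linear_bound_at_0:
  fixes q :: "real \<Rightarrow> real"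
  assumes "q differentiable at 0" "q 0 = 0"
  obtains C d where "0 < C" "0 < d" "\<And>z. 0 \<le> z \<Longrightarrow> z < d \<Longrightarrow> \<bar>q z\<bar> \<le> C * z"
proof -
  obtain D where D: "(q has_real_derivative D) (at 0)"
    using assms(1) by (auto simp: real_differentiable_def)
  have "((\<lambda>h. q h / h) \<longlongrightarrow> D) (at 0)"
    using D assms(2) unfolding DERIV_def by simp
  then have "eventually (\<lambda>h. dist (q h / h) D < 1) (at 0)"
    by (rule tendstoD) simp
  then obtain d where d: "d > 0" "\<And>h. h \<noteq> 0 \<Longrightarrow> \<bar>h\<bar> < d \<Longrightarrow> dist (q h / h) D < 1"
    by (auto simp: eventually_at)
  have "\<bar>q z\<bar> \<le> (\<bar>D\<bar> + 1) * z" if "0 \<le> z" "z < d" for z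
  proof (cases "z = 0")
    case False
    then have "\<bar>q z / z\<bar> \<le> \<bar>D\<bar> + 1" using d(2)[of z] that by (auto simp: dist_real_def)
    then show ?thesis using False that by (auto simp: field_simps abs_divide)
  qed (use assms in auto)
  then show thesis using that[of "\<bar>D\<bar> + 1" d] d by auto
qed

lemma abs_diff_le_of_derivative_bound:
  fixes F f :: "real \<Rightarrow> real"
  assumes F: "\<And>x. (F has_real_derivative f x) (at x)"
    and B: "\<And>y. 0 \<le> y \<Longrightarrow> y \<le> z \<Longrightarrow> \<bar>f y\<bar> \<le> B" and "0 \<le> z" "F 0 = 0"
  shows "\<bar>F z\<bar> \<le> B * z"
proof (cases "z = 0")
  case False
  then obtain y where "0 < y" "y < z" "F z - F 0 = (z - 0) * f y"
    using MVT2[of 0 z F f] F \<open>0 \<le> z\<close> by auto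
  then show ?thesis using B[of y] assms(3,4)
    by (simp add: abs_mult mult.commute mult_left_mono)
qed (use assms in auto)

subsection \<open>Principal value limits\<close>

text \<open>Folding the principal value at \<open>x\<close> leaves a one-sided integral of
  \<open>q z = \<rho> (x - z) - \<rho> (x + z)\<close>.\<close>

definition pv_lim :: "real \<Rightarrow> (real \<Rightarrow> real) \<Rightarrow> real \<Rightarrow> bool" where
  "pv_lim a q v \<longleftrightarrow>
     ((\<lambda>(e, R). integral {e..R} (\<lambda>z. q z * z powr (-a))) \<longlongrightarrow> v) (at_right 0 \<times>\<^sub>F at_top)"

lemma pv_filter_nontrivial: "(at_right 0 :: real filter) \<times>\<^sub>F (at_top :: real filter) \<noteq> bot"
  by (simp add: prod_filter_eq_bot)

lemma eventually_pv_filter: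
  fixes d r :: real
  assumes "0 < d" "\<And>e R. 0 < e \<Longrightarrow> e < d \<Longrightarrow> r < R \<Longrightarrow> Q (e, R)"
  shows "eventually Q (at_right 0 \<times>\<^sub>F at_top)"
  unfolding eventually_prod_filter
proof (intro exI conjI allI impI)
  show "eventually (\<lambda>e. 0 < e \<and> e < d) (at_right 0)"
    using assms(1) by (auto simp: eventually_at_right)
  show "eventually (\<lambda>R. r < R) at_top" by (rule eventually_gt_at_top)
qed (use assms in auto)

lemma pv_lim_unique: "pv_lim a q v \<Longrightarrow> pv_lim a q w \<Longrightarrow> v = w"
  unfolding pv_lim_def by (rule tendsto_unique[OF pv_filter_nontrivial])

lemma powr_weighted_integrable:
  fixes q :: "real \<Rightarrow> real"
  assumes "continuous_on UNIV q" "0 < e"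
  shows "(\<lambda>z. q z * z powr (-a)) integrable_on {e..R}"
  using assms
  by (intro integrable_continuous_real continuous_intros) (auto intro: continuous_on_subset)

lemma pv_lim_lincomb:
  assumes "pv_lim a p v" "pv_lim a q w" "continuous_on UNIV p" "continuous_on UNIV q"
  shows "pv_lim a (\<lambda>z. p z + k * q z) (v + k * w)"
proof -
  have "((\<lambda>x. (case x of (e, R) \<Rightarrow> integral {e..R} (\<lambda>z. p z * z powr (-a))) +
      k * (case x of (e, R) \<Rightarrow> integral {e..R} (\<lambda>z. q z * z powr (-a)))) \<longlongrightarrow> v + k * w)
      (at_right 0 \<times>\<^sub>F at_top)"
    using assms(1,2) unfolding pv_lim_def by (intro tendsto_intros)
  moreover have "eventually (\<lambda>x. (case x of (e, R) \<Rightarrow> integral {e..R} (\<lambda>z. p z * z powr (-a))) +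
      k * (case x of (e, R) \<Rightarrow> integral {e..R} (\<lambda>z. q z * z powr (-a))) =
      (case x of (e, R) \<Rightarrow> integral {e..R} (\<lambda>z. (p z + k * q z) * z powr (-a))))
      (at_right 0 \<times>\<^sub>F at_top)"
  proof (rule eventually_pv_filter[where d = 1 and r = 0])
    fix e R :: real assume "0 < e"
    then have "(\<lambda>z. p z * z powr (-a)) integrable_on {e..R}" "(\<lambda>z. q z * z powr (-a)) integrable_on {e..R}"
      using assms(3,4) powr_weighted_integrable by blast+
    then have "integral {e..R} (\<lambda>z. p z * z powr (-a) + k * (q z * z powr (-a))) =
        integral {e..R} (\<lambda>z. p z * z powr (-a)) + integral {e..R} (\<lambda>z. k * (q z * z powr (-a)))"
      by (intro integral_add integrable_on_cmult_left[where 'b = real, simplified])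
    then show "(case (e, R) of (e, R) \<Rightarrow> integral {e..R} (\<lambda>z. p z * z powr (-a))) +
      k * (case (e, R) of (e, R) \<Rightarrow> integral {e..R} (\<lambda>z. q z * z powr (-a))) =
      (case (e, R) of (e, R) \<Rightarrow> integral {e..R} (\<lambda>z. (p z + k * q z) * z powr (-a)))"
      by (simp add: algebra_simps)
  qed simp
  ultimately show ?thesis
    unfolding pv_lim_def by (rule Lim_transform_eventually)
qed

text \<open>\<open>\<Psi>\<close> is an explicit antiderivative of a majorant, so a truncated
  integral is at most the difference of two boundary values. These are controlled by R^(-a) and
  e^(2-a), which vanish in the limit since 0 < a < 2. \<open>\<kappa>\<close> is a gap between
  integrand and majorant on \<open>{b..d}\<close> that survives the limit.\<close>

lemma pv_lim_upper:
  fixes q \<Psi> \<psi> :: "real \<Rightarrow> real"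
  assumes a: "0 < a" "a < 2" and q: "continuous_on UNIV q" and lim: "pv_lim a q v"
    and \<Psi>: "\<And>z. 0 < z \<Longrightarrow> (\<Psi> has_real_derivative \<psi> z) (at z)"
    and le: "\<And>z. 0 < z \<Longrightarrow> q z * z powr (-a) + (if z \<in> {b..d} then \<kappa> else 0) \<le> \<psi> z"
    and bd: "0 < b" "b \<le> d"
    and top: "\<And>z. 1 \<le> z \<Longrightarrow> \<Psi> z \<le> B * z powr (-a)"
    and zero: "0 < r" "\<And>z. 0 < z \<Longrightarrow> z < r \<Longrightarrow> - C * z powr (2 - a) \<le> \<Psi> z"
  shows "v \<le> - (\<kappa> * (d - b))"
proof -
  have "((\<lambda>x. B * snd x powr (-a) + C * fst x powr (2 - a) - \<kappa> * (d - b)) \<longlongrightarrow>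
       B * 0 + C * 0 - \<kappa> * (d - b)) (at_right 0 \<times>\<^sub>F at_top)"
  proof (intro tendsto_intros)
    have "((\<lambda>z. z powr (-a)) \<longlongrightarrow> 0) at_top" 
      using a by (intro tendsto_neg_powr filterlim_ident) auto
    then show "((\<lambda>x. snd x powr (-a)) \<longlongrightarrow> 0) (at_right 0 \<times>\<^sub>F at_top)"
      by (rule filterlim_compose) (rule filterlim_snd)
    have "((\<lambda>z. z powr (2 - a)) \<longlongrightarrow> 0 powr (2 - a)) (at_right 0)"
      using a by (intro tendsto_powr' tendsto_ident_at tendsto_const)
        (auto simp: eventually_at_right_less intro!: eventually_at_rightI[of 0 1])
    then have "((\<lambda>z. z powr (2 - a)) \<longlongrightarrow> 0) (at_right 0)" by simp
    then show "((\<lambda>x. fst x powr (2 - a)) \<longlongrightarrow> 0) (at_right 0 \<times>\<^sub>F at_top)"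
      by (rule filterlim_compose) (rule filterlim_fst)
  qed
  moreover have "eventually (\<lambda>x. (case x of (e, R) \<Rightarrow> integral {e..R} (\<lambda>z. q z * z powr (-a))) \<le>
      B * snd x powr (-a) + C * fst x powr (2 - a) - \<kappa> * (d - b)) (at_right 0 \<times>\<^sub>F at_top)"
  proof (rule eventually_pv_filter[where d = "min b (min r 1)" and r = "max d 1"])
    fix e R assume e: "0 < e" "e < min b (min r 1)" and R: "max d 1 < R"
    have "(\<psi> has_integral (\<Psi> R - \<Psi> e)) {e..R}"
      using e R by (intro fundamental_theorem_of_calculus)
        (auto simp: has_real_derivative_iff_has_vector_derivative[symmetric]
          intro!: has_field_derivative_at_within[OF \<Psi>])
    moreover have "((\<lambda>z. if z \<in> {b..d} then \<kappa> else 0) has_integral (\<kappa> * (d - b))) {e..R}"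
      using has_integral_restrict_closed_subinterval[of "\<lambda>_. \<kappa>" "\<kappa> * (d - b)" b d e R]
        has_integral_const_real[of \<kappa> b d] e R bd by (simp add: mult.commute)
    ultimately have *: "((\<lambda>z. \<psi> z - (if z \<in> {b..d} then \<kappa> else 0)) has_integral
        (\<Psi> R - \<Psi> e - \<kappa> * (d - b))) {e..R}"
      by (rule has_integral_diff)
    have "integral {e..R} (\<lambda>z. q z * z powr (-a)) \<le> \<Psi> R - \<Psi> e - \<kappa> * (d - b)"
    proof (rule has_integral_le[OF integrable_integral *])
      show "(\<lambda>z. q z * z powr (-a)) integrable_on {e..R}"
        using q e(1) by (rule powr_weighted_integrable)
      show "q z * z powr (-a) \<le> \<psi> z - (if z \<in> {b..d} then \<kappa> else 0)" if "z \<in> {e..R}" for z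
        using le[of z] that e by simp
    qed
    then show "(case (e, R) of (e, R) \<Rightarrow> integral {e..R} (\<lambda>z. q z * z powr (-a))) \<le>
      B * snd (e, R) powr (-a) + C * fst (e, R) powr (2 - a) - \<kappa> * (d - b)"
      using top[of R] zero(2)[of e] e R by simp
  qed (use bd zero in auto)
  ultimately have "v \<le> B * 0 + C * 0 - \<kappa> * (d - b)"
    using lim unfolding pv_lim_def by (intro tendsto_le[OF pv_filter_nontrivial])
  then show ?thesis by simp
qed

text \<open>The majorant is the derivative of \<open>Q z * z powr (-a)\<close>. It exceeds the
  integrand by -a Q z^(-a-1), which is nonnegative where Q \<le> 0 and at least a \<kappa> on
  \<open>{b..d}\<close>.\<close>

lemma pv_lim_by_parts:
  fixes q Q :: "real \<Rightarrow> real"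
  assumes a: "0 < a" "a < 2" and lim: "pv_lim a q v"
    and Q: "\<And>z. (Q has_real_derivative q z) (at z)" "Q 0 = 0"
    and q: "continuous_on UNIV q" "q 0 = 0" "q differentiable (at 0)"
    and Q_le: "\<And>z. 0 \<le> z \<Longrightarrow> Q z \<le> 0"
    and bd: "0 < b" "b \<le> d" "d \<le> 1" and \<kappa>: "0 \<le> \<kappa>" "\<And>z. b \<le> z \<Longrightarrow> z \<le> d \<Longrightarrow> Q z \<le> - \<kappa>"
  shows "v \<le> - (a * \<kappa> * (d - b))"
proof -
  obtain C r where Cr: "0 < C" "0 < r" "\<And>z. 0 \<le> z \<Longrightarrow> z < r \<Longrightarrow> \<bar>q z\<bar> \<le> C * z"
    using linear_bound_at_0[OF q(3,2)] by blast
  show ?thesis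
  proof (rule pv_lim_upper[where \<Psi> = "\<lambda>z. Q z * z powr (-a)" and B = 0 and C = C and r = r
        and \<psi> = "\<lambda>z. q z * z powr (-a) + Q z * (- a * z powr (-a - 1))", OF a q(1) lim _ _ bd(1,2)])
    fix z :: real assume z: "0 < z"
    show "((\<lambda>z. Q z * z powr (-a)) has_real_derivative
        q z * z powr (-a) + Q z * (- a * z powr (-a - 1))) (at z)"
      using z by (auto intro!: derivative_eq_intros Q)
    show "q z * z powr (-a) + (if z \<in> {b..d} then a * \<kappa> else 0)
        \<le> q z * z powr (-a) + Q z * (- a * z powr (-a - 1))"
    proof (cases "z \<in> {b..d}")
      case True
      \<comment> \<open>Here z \<le> d \<le> 1, so a negative power of z is at least 1.\<close>
      have "1 \<le> z powr (-a - 1)"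
        using True bd z a powr_mono'[of "-a - 1" 0 z] by simp
      then have "\<kappa> * 1 \<le> (- Q z) * z powr (-a - 1)"
        using \<kappa>(2)[of z] True \<kappa>(1) by (intro mult_mono) auto
      then have "a * (\<kappa> * 1) \<le> a * ((- Q z) * z powr (-a - 1))"
        using a by (intro mult_left_mono) auto
      with True show ?thesis by (auto simp: algebra_simps)
    next
      case False
      have "0 \<le> (- Q z) * (a * z powr (-a - 1))"
        using Q_le[of z] z a by (intro mult_nonneg_nonneg) auto
      with False show ?thesis by (auto simp: algebra_simps)
    qed
  next
    fix z :: real assume "1 \<le> z"
    then show "Q z * z powr (-a) \<le> 0 * z powr (-a)"
      using Q_le[of z] by (simp add: mult_nonpos_nonneg)
  next
    fix z :: real assume z: "0 < z"
    show "- C * z powr (2 - a) \<le> Q z * z powr (-a)" if "z < r"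
    proof -
      have "\<bar>Q z\<bar> \<le> C * z * z"
        using Q(1) Cr that z
        by (intro abs_diff_le_of_derivative_bound[of Q q])
          (auto simp: Q(2) intro: order.trans[OF Cr(3)])
      then have "- (C * z * z) * z powr (-a) \<le> Q z * z powr (-a)"
        by (intro mult_right_mono) auto
      moreover have "z powr (2 - a) = z * z * z powr (-a)"
        using z by (simp add: powr_diff powr_minus field_simps power2_eq_square)
      ultimately show ?thesis by (simp add: algebra_simps)
    qed
  qed (use Cr in auto)
qed

text \<open>The weight is completely monotone, so it suffices that the third antiderivative of \<open>q\<close>
  has a sign; for odd \<open>f\<close> the first two need not.\<close>

lemma pv_lim_by_parts_thrice:
  fixes q Q R U :: "real \<Rightarrow> real"
  assumes a: "0 < a" "a < 2" and lim: "pv_lim a q v"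
    and Q: "\<And>z. (Q has_real_derivative q z) (at z)" "Q 0 = 0"
    and R: "\<And>z. (R has_real_derivative Q z) (at z)" "R 0 = 0"
    and U: "\<And>z. (U has_real_derivative R z) (at z)" "U 0 = 0"
    and q: "continuous_on UNIV q" "q 0 = 0" "q differentiable (at 0)"
    and U_le: "\<And>z. 0 \<le> z \<Longrightarrow> U z \<le> 0"
    and B: "\<And>z. 0 \<le> z \<Longrightarrow> \<bar>Q z\<bar> \<le> B"
  shows "v \<le> 0"
proof -
  obtain C r where Cr: "0 < C" "0 < r" "\<And>z. 0 \<le> z \<Longrightarrow> z < r \<Longrightarrow> \<bar>q z\<bar> \<le> C * z"
    using linear_bound_at_0[OF q(3,2)] by blast
  define K where "K = a * (a + 1)"
  have K: "K > 0" using a by (simp add: K_def)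
  \<comment> \<open>Boundary terms of three integrations by parts. The coefficients \<open>a\<close>
    and \<open>K\<close> make the terms in \<open>Q\<close> and \<open>R\<close> cancel in the
    derivative, which leaves \<open>q z * z powr (-a)\<close> and a term in \<open>U\<close> with a
    favourable sign.\<close>
  define \<Psi> where "\<Psi> z = Q z * z powr (-a) + a * R z * z powr (-a - 1) + K * U z * z powr (-a - 2)" for z
  define \<psi> where "\<psi> z = q z * z powr (-a) + K * U z * ((-a - 2) * z powr (-a - 3))" for z
  have "v \<le> - (0 * (1 - 1))"
  proof (rule pv_lim_upper[where \<Psi> = \<Psi> and \<psi> = \<psi> and B = "B + a * B" and C = "C + a * C + K * C" and r = r,
        OF a q(1) lim])
    fix z :: real assume z: "0 < z"
    show "(\<Psi> has_real_derivative \<psi> z) (at z)"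
      unfolding \<Psi>_def using z
      by (auto intro!: derivative_eq_intros Q R U simp: \<psi>_def K_def algebra_simps)
    show "q z * z powr (-a) + (if z \<in> {1..1} then 0 else 0) \<le> \<psi> z"
    proof -
      have "0 \<le> K * (- U z) * ((a + 2) * z powr (-a - 3))"
        using U_le[of z] z a K by (intro mult_nonneg_nonneg) auto
      then show ?thesis by (auto simp: \<psi>_def algebra_simps)
    qed
  next
    fix z :: real assume "1 \<le> z"
    then have z: "0 < z" by simp
    show "\<Psi> z \<le> (B + a * B) * z powr (-a)"
    proof -
      have "\<bar>R z\<bar> \<le> B * z"
        using R B z by (intro abs_diff_le_of_derivative_bound[of R Q]) auto
      then have "R z * z powr (-a - 1) \<le> B * z * z powr (-a - 1)"
        by (intro mult_right_mono) auto
      also have "\<dots> = B * z powr (-a)" using z by (simp add: powr_diff)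
      finally have "a * (R z * z powr (-a - 1)) \<le> a * (B * z powr (-a))"
        using a by (intro mult_left_mono) auto
      moreover have "Q z * z powr (-a) \<le> B * z powr (-a)"
        using B[of z] z by (intro mult_right_mono) auto
      moreover have "0 \<le> K * (- U z) * z powr (-a - 2)"
        using U_le[of z] z K by (intro mult_nonneg_nonneg) auto
      ultimately show ?thesis by (simp add: \<Psi>_def algebra_simps)
    qed
  next
    fix z :: real assume z: "0 < z"
    show "- (C + a * C + K * C) * z powr (2 - a) \<le> \<Psi> z" if "z < r"
    proof -
      have Q_bound: "\<bar>Q y\<bar> \<le> C * y * y" if "0 \<le> y" "y \<le> z" for y
        using Q Cr \<open>z < r\<close> that
        by (intro abs_diff_le_of_derivative_bound[of Q q])
          (auto intro: order.trans[OF Cr(3)])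
      have R_bound: "\<bar>R y\<bar> \<le> C * y * y * y" if "0 \<le> y" "y \<le> z" for y
        using R Q_bound Cr that
        by (intro abs_diff_le_of_derivative_bound[of R Q])
          (auto intro!: order.trans[OF Q_bound] mult_mono)
      have U_bound: "\<bar>U z\<bar> \<le> C * z * z * z * z"
        using U R_bound Cr z
        by (intro abs_diff_le_of_derivative_bound[of U R])
          (auto intro!: order.trans[OF R_bound] mult_mono)
      have powr: "z powr (2 - a) = z * z * z powr (-a)" "z * z powr (-a - 1) = z powr (-a)"
        "z * z * z powr (-a - 2) = z powr (-a)"
        using z by (simp_all add: powr_diff powr_minus field_simps power2_eq_square)
      have "- (C * z * z) * z powr (-a) \<le> Q z * z powr (-a)"
        using Q_bound[of z] z by (intro mult_right_mono) auto
      then have Q_low: "- C * z powr (2 - a) \<le> Q z * z powr (-a)"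
        by (simp add: powr mult.assoc)
      have "- (C * z * z * z) * z powr (-a - 1) \<le> R z * z powr (-a - 1)"
        using R_bound[of z] z by (intro mult_right_mono) auto
      moreover have "- (C * z * z * z) * z powr (-a - 1) = - C * (z * z * (z * z powr (-a - 1)))"
        by (simp add: mult.assoc)
      ultimately have R_low: "- C * z powr (2 - a) \<le> R z * z powr (-a - 1)"
        by (simp only: powr)
      have "- (C * z * z * z * z) * z powr (-a - 2) \<le> U z * z powr (-a - 2)"
        using U_bound z by (intro mult_right_mono) auto
      moreover have "- (C * z * z * z * z) * z powr (-a - 2) = - C * (z * z * (z * z * z powr (-a - 2)))"
        by (simp add: mult.assoc)
      ultimately have U_low: "- C * z powr (2 - a) \<le> U z * z powr (-a - 2)"
        by (simp only: powr)
      show ?thesis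
        using Q_low mult_left_mono[OF R_low, of a] mult_left_mono[OF U_low, of K] a K
        by (simp add: \<Psi>_def algebra_simps)
    qed
  qed (use Cr in auto)
  then show ?thesis by simp
qed

subsection \<open>The primitive of a classical solution\<close>

lemma c_alpha_pos:
  assumes "0 < a" "a < 2"
  shows "0 < c_alpha a"
  using assms by (auto simp: c_alpha_def intro!: divide_pos_pos mult_pos_pos Gamma_real_pos)

text \<open>Substitute y = x - z on the left half of the annulus and y = x + z on the right half.
  The kernel has opposite signs there, so the two copies of \<open>rho x t\<close> cancel.\<close>

lemma pv_velocity_imp_pv_lim:
  assumes a: "0 < a" "a < 2" and pv: "pv_velocity a rho x t v"
    and rho: "continuous_on UNIV (\<lambda>y. rho y t)"
  shows "pv_lim a (\<lambda>z. rho (x - z) t - rho (x + z) t) (v / c_alpha a)"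
proof -
  define g where "g y = (rho y t - rho x t) / (sgn (x - y) * \<bar>x - y\<bar> powr a)" for y
  have c: "c_alpha a > 0" using a by (rule c_alpha_pos)
  have "integral {y. e < \<bar>x - y\<bar> \<and> \<bar>x - y\<bar> < R} g =
      integral {e..R} (\<lambda>z. (rho (x - z) t - rho (x + z) t) * z powr (-a))"
    if e: "0 < e" "e < 1" and R: "1 < R" for e R
  proof -
    define k where "k z = (rho (x - z) t - rho x t) * z powr (-a)" for z
    define l where "l z = (rho x t - rho (x + z) t) * z powr (-a)" for z
    have rho_comp: "continuous_on S (\<lambda>z. rho (f z) t)" if "continuous_on S f" for S and f :: "real \<Rightarrow> real"
      using continuous_on_compose2[OF rho that] by simp
    have kl: "k integrable_on {e..R}" "l integrable_on {e..R}"
      unfolding k_def l_def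
      by (intro powr_weighted_integrable[OF _ e(1)] continuous_intros rho_comp)+
    have "((\<lambda>y. k (-1 *\<^sub>R y + x)) has_integral integral {e..R} k) {x - R..x - e}"
      using has_integral_affinity[of k "integral {e..R} k" e R "-1" x] kl(1) e R
      by (simp add: integrable_integral image_affinity_atLeastAtMost)
    moreover have "k (-1 *\<^sub>R y + x) = g y" if "y \<in> {x - R..x - e}" for y
      using that e by (simp add: k_def g_def powr_minus field_simps)
    ultimately have left: "(g has_integral integral {e..R} k) {x - R..x - e}"
      by (rule has_integral_eq[rotated])
    have "((\<lambda>y. l (1 *\<^sub>R y + (- x))) has_integral integral {e..R} l) {x + e..x + R}"
      using has_integral_affinity[of l "integral {e..R} l" e R 1 "- x"] kl(2) e R
      by (simp add: integrable_integral add.commute)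
    moreover have "l (1 *\<^sub>R y + (- x)) = g y" if "y \<in> {x + e..x + R}" for y
      using that e by (simp add: l_def g_def powr_minus field_simps)
    ultimately have right: "(g has_integral integral {e..R} l) {x + e..x + R}"
      by (rule has_integral_eq[rotated])
    have "{x - R..x - e} \<inter> {x + e..x + R} = {}" using e by auto
    then have "(g has_integral integral {e..R} k + integral {e..R} l) ({x - R..x - e} \<union> {x + e..x + R})"
      using left right by (intro has_integral_Un) auto
    moreover have eq: "{y. e < \<bar>x - y\<bar> \<and> \<bar>x - y\<bar> < R} = {x - R<..<x - e} \<union> {x + e<..<x + R}"
      using e by (auto simp: abs_if)
    \<comment> \<open>The annulus is open while the substitutions live on closed intervals; the two
      sets differ in four points.\<close>
    have "negligible {x - R, x - e, x + e, x + R}" by simp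
    then have "negligible (({x - R..x - e} \<union> {x + e..x + R}) - {y. e < \<bar>x - y\<bar> \<and> \<bar>x - y\<bar> < R})"
      by (rule negligible_subset) (auto simp: eq)
    moreover have "{y. e < \<bar>x - y\<bar> \<and> \<bar>x - y\<bar> < R} - ({x - R..x - e} \<union> {x + e..x + R}) = {}"
      by (auto simp: eq)
    ultimately have "(g has_integral integral {e..R} k + integral {e..R} l) {y. e < \<bar>x - y\<bar> \<and> \<bar>x - y\<bar> < R}"
      by (subst has_integral_spike_set_eq[where T = "{x - R..x - e} \<union> {x + e..x + R}"])
        (auto intro: negligible_subset)
    moreover have "integral {e..R} k + integral {e..R} l = integral {e..R} (\<lambda>z. k z + l z)"
      using kl by (simp add: integral_add)
    ultimately show ?thesis
      by (simp add: integral_unique k_def l_def flip: distrib_right)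
  qed
  then have "eventually (\<lambda>w. (case w of (e, R) \<Rightarrow> c_alpha a * integral {y. e < \<bar>x - y\<bar> \<and> \<bar>x - y\<bar> < R} g) / c_alpha a
      = (case w of (e, R) \<Rightarrow> integral {e..R} (\<lambda>z. (rho (x - z) t - rho (x + z) t) * z powr (-a))))
      (at_right 0 \<times>\<^sub>F at_top)"
    using c by (intro eventually_pv_filter[where d = 1 and r = 1]) auto
  moreover have "((\<lambda>w. (case w of (e, R) \<Rightarrow> c_alpha a * integral {y. e < \<bar>x - y\<bar> \<and> \<bar>x - y\<bar> < R} g) / c_alpha a)
      \<longlongrightarrow> v / c_alpha a) (at_right 0 \<times>\<^sub>F at_top)"
    using pv c unfolding pv_velocity_def g_def by (intro tendsto_intros) auto
  ultimately show ?thesis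
    unfolding pv_lim_def by (rule Lim_transform_eventually[rotated])
qed

text \<open>Here \<open>u\<close> is the velocity of the paper divided by its constant, which reappears as \<open>c\<close>.\<close>

locale transport =
  fixes a c :: real and P \<rho> u :: "real \<Rightarrow> real \<Rightarrow> real"
  assumes a_pos: "0 < a" and a_less: "a < 2" and c_pos: "0 < c"
    and P_cont: "continuous_on (UNIV \<times> {0..}) (\<lambda>(x, t). P x t)"
    and P_0: "P 0 t = 0"
    and P_deriv: "0 \<le> t \<Longrightarrow> ((\<lambda>y. P y t) has_real_derivative \<rho> x t) (at x)"
    and P_time_deriv: "0 < t \<Longrightarrow>
      ((\<lambda>s. P x s) has_real_derivative c * (\<rho> 0 t * u 0 t - \<rho> x t * u x t)) (at t)"
    and \<rho>_periodic: "0 \<le> t \<Longrightarrow> \<rho> (x + 1) t = \<rho> x t"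
    and \<rho>_differentiable: "0 \<le> t \<Longrightarrow> (\<lambda>y. \<rho> y t) differentiable (at x)"
    and u_lim: "0 \<le> t \<Longrightarrow> pv_lim a (\<lambda>z. \<rho> (x - z) t - \<rho> (x + z) t) (u x t)"

lemma continuous_on_curried_compose:
  fixes g :: "'a::topological_space \<Rightarrow> 'b::topological_space \<Rightarrow> 'c::topological_space"
  assumes "continuous_on (UNIV \<times> T) (\<lambda>(x, t). g x t)" "continuous_on S f" "continuous_on S h" "h ` S \<subseteq> T"
  shows "continuous_on S (\<lambda>y. g (f y) (h y))"
  using continuous_on_compose2[OF assms(1) continuous_on_Pair[OF assms(2,3)]] assms(4) by auto

lemma classical_solution_transport:
  assumes a: "0 < a" "a < 2" and sol: "classical_solution a rho0 rho u" and "smooth_real rho0"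
  obtains P where "transport a (c_alpha a) P rho (\<lambda>x t. u x t / c_alpha a)"
proof -
  note cs = sol[unfolded classical_solution_def]
  have c: "c_alpha a > 0" using a by (rule c_alpha_pos)
  have rho_cont: "continuous_on (UNIV \<times> {0..}) (\<lambda>(x, t). rho x t)" using cs by blast
  have rho_cont_x: "continuous_on S (\<lambda>y. rho (f y) t)" if "0 \<le> t" "continuous_on S f"
    for t S and f :: "real \<Rightarrow> real"
    using that by (intro continuous_on_curried_compose[OF rho_cont]) auto
  define rho' where "rho' x t = deriv (\<lambda>s. rho x s) t" for x t
  have flux: "((\<lambda>y. rho y t * u y t) has_real_derivative - rho' x t) (at x)"
    and rho_t: "((\<lambda>s. rho x s) has_real_derivative rho' x t) (at t)" if "0 < t" for x t
  proof -
    have *: "(\<lambda>s. rho x s) differentiable (at t)" "(\<lambda>y. rho y t * u y t) differentiable (at x)"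
      "deriv (\<lambda>s. rho x s) t + deriv (\<lambda>y. rho y t * u y t) x = 0"
      using cs that by blast+
    from *(1) show "((\<lambda>s. rho x s) has_real_derivative rho' x t) (at t)"
      unfolding rho'_def by (simp add: DERIV_deriv_iff_real_differentiable)
    from *(3) have "- rho' x t = deriv (\<lambda>y. rho y t * u y t) x" by (simp add: rho'_def)
    with *(2) show "((\<lambda>y. rho y t * u y t) has_real_derivative - rho' x t) (at x)"
      by (simp add: DERIV_deriv_iff_real_differentiable)
  qed
  have rho'_cont: "continuous_on (UNIV \<times> {0<..}) (\<lambda>(x, t). rho' x t)"
    using cs by (simp add: rho'_def)
  \<comment> \<open>Substituting y = x s turns the integral from 0 to x into one over a fixed
    interval. The sign is right for negative x too, and continuity in parameters and differentiation
    under the integral apply directly.\<close>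
  define P where "P x t = integral (cbox 0 1) (\<lambda>s. x * rho (x * s) t)" for x t
  have "transport a (c_alpha a) P rho (\<lambda>x t. u x t / c_alpha a)"
  proof
    show "0 < a" "a < 2" "0 < c_alpha a" using a c by auto
    show "P 0 t = 0" for t by (simp add: P_def)
    have "continuous_on ((UNIV \<times> {0..}) \<times> cbox 0 1) (\<lambda>(p, s). fst p * rho (fst p * s) (snd p))"
      unfolding case_prod_unfold
      by (intro continuous_intros continuous_on_curried_compose[OF rho_cont]) auto
    then have "continuous_on (UNIV \<times> {0..})
        (\<lambda>p. integral (cbox 0 1) (\<lambda>s. fst p * rho (fst p * s) (snd p)))"
      by (rule integral_continuous_on_param)
    then show "continuous_on (UNIV \<times> {0..}) (\<lambda>(x, t). P x t)"
      by (simp add: P_def case_prod_unfold)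
    show "((\<lambda>y. P y t) has_real_derivative rho x t) (at x)" if t: "0 \<le> t" for x t
    proof -
      obtain F where F: "F 0 = 0" "\<And>x. (F has_real_derivative rho x t) (at x)"
        using antiderivative_exists[of "\<lambda>y. rho y t"] rho_cont_x[OF t continuous_on_id] by blast
      have "((\<lambda>s. y * rho (y * s) t) has_integral F (y * 1) - F (y * 0)) {0..1}" for y
      proof (rule fundamental_theorem_of_calculus)
        fix s
        have "((\<lambda>s. F (y * s)) has_real_derivative rho (y * s) t * y) (at s)"
          by (rule DERIV_chain2[OF F(2)]) (auto intro!: derivative_eq_intros)
        from has_field_derivative_at_within[OF this] show "((\<lambda>s. F (y * s)) has_vector_derivative y * rho (y * s) t) (at s within {0..1})"
          by (simp add: has_real_derivative_iff_has_vector_derivative[symmetric] mult.commute)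
      qed simp
      then have "P y t = F (y * 1) - F (y * 0)" for y
        unfolding P_def box_real by (rule integral_unique)
      then have "(\<lambda>y. P y t) = F" using F(1) by auto
      then show ?thesis using F(2) by simp
    qed
    show "((\<lambda>s. P x s) has_real_derivative c_alpha a *
      (rho 0 t * (u 0 t / c_alpha a) - rho x t * (u x t / c_alpha a))) (at t)" if "0 < t" for x t
    proof -
      \<comment> \<open>Differentiation under the integral takes place on positive times, where the
        equation holds; the conservation law then makes the integrand the exact derivative of minus
        the flux.\<close>
      have "((\<lambda>s. P x s) has_real_derivative integral (cbox 0 1) (\<lambda>y. x * rho' (x * y) t)) (at t within {0<..})"
        unfolding P_def
      proof (rule leibniz_rule_field_derivative)
        show "((\<lambda>s. x * rho (x * y) s) has_real_derivative x * rho' (x * y) s) (at s within {0<..})"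
          if "s \<in> {0<..}" for s y
          using that by (intro DERIV_cmult has_field_derivative_at_within[OF rho_t]) auto
        show "(\<lambda>y. x * rho (x * y) s) integrable_on cbox 0 1" if "s \<in> {0<..}" for s
          using that by (intro integrable_continuous continuous_intros rho_cont_x) auto
        show "continuous_on ({0<..} \<times> cbox 0 1) (\<lambda>(s, y). x * rho' (x * y) s)"
          unfolding case_prod_unfold
          by (intro continuous_intros continuous_on_curried_compose[OF rho'_cont]) auto
      qed (use that in auto)
      then have "((\<lambda>s. P x s) has_real_derivative integral {0..1} (\<lambda>y. x * rho' (x * y) t)) (at t)"
        using that at_within_open[of t "{0<..}"] by simp
      moreover have "((\<lambda>y. x * rho' (x * y) t) has_integral
          (- (rho (x * 1) t * u (x * 1) t)) - (- (rho (x * 0) t * u (x * 0) t))) {0..1}"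
      proof (rule fundamental_theorem_of_calculus)
        fix y :: real
        have "((\<lambda>y. rho (x * y) t * u (x * y) t) has_real_derivative - rho' (x * y) t * x) (at y)"
          by (rule DERIV_chain2[OF flux[OF that]]) (auto intro!: derivative_eq_intros)
        from has_field_derivative_at_within[OF DERIV_minus[OF this]] show "((\<lambda>y. - (rho (x * y) t * u (x * y) t)) has_vector_derivative
            x * rho' (x * y) t) (at y within {0..1})"
          by (simp add: has_real_derivative_iff_has_vector_derivative[symmetric] mult.commute)
      qed simp
      then have "integral {0..1} (\<lambda>y. x * rho' (x * y) t) = c_alpha a *
          (rho 0 t * (u 0 t / c_alpha a) - rho x t * (u x t / c_alpha a))"
        using c by (subst integral_unique) (auto simp: right_diff_distrib)
      ultimately show ?thesis by (simp only:)
    qed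
    show "rho (x + 1) t = rho x t" if "0 \<le> t" for x t using cs that by blast
    show "(\<lambda>y. rho y t) differentiable (at x)" if "0 \<le> t" for x t
    proof (cases "t = 0")
      \<comment> \<open>The equation speaks of positive times; at time 0 differentiability comes
        from the datum.\<close>
      case True
      have "rho0 differentiable (at x)"
        using spec[OF spec[OF assms(4)[unfolded smooth_real_def], of 0], of x] by simp
      moreover have "(\<lambda>y. rho y 0) = rho0" using cs by auto
      ultimately show ?thesis using True by simp
    qed (use cs that in auto)
    show "pv_lim a (\<lambda>z. rho (x - z) t - rho (x + z) t) (u x t / c_alpha a)" if "0 \<le> t" for x t
      using a cs that rho_cont_x[OF that continuous_on_id]
      by (intro pv_velocity_imp_pv_lim) auto
  qed
  then show thesis using that by blast
qed

context transport
begin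

lemma \<rho>_cont: "0 \<le> t \<Longrightarrow> continuous_on S (\<lambda>y. \<rho> y t)"
  using \<rho>_differentiable differentiable_imp_continuous_within
  by (intro continuous_at_imp_continuous_on) blast

lemma \<rho>_cont_comp: "0 \<le> t \<Longrightarrow> continuous_on S f \<Longrightarrow> continuous_on S (\<lambda>y. \<rho> (f y) t)"
  by (rule continuous_on_compose2[OF \<rho>_cont[of t UNIV]]) auto

lemma P_cont_comp: "continuous_on S f \<Longrightarrow> continuous_on S g \<Longrightarrow> (\<And>y. y \<in> S \<Longrightarrow> 0 \<le> g y)
   \<Longrightarrow> continuous_on S (\<lambda>y. P (f y) (g y))"
  by (rule continuous_on_curried_compose[OF P_cont]) auto

lemma u_periodic: "0 \<le> t \<Longrightarrow> u (x + 1) t = u x t"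
proof -
  assume t: "0 \<le> t"
  have "\<rho> (x + 1 - z) t = \<rho> (x - z) t" "\<rho> (x + 1 + z) t = \<rho> (x + z) t" for z
    using \<rho>_periodic[OF t, of "x - z"] \<rho>_periodic[OF t, of "x + z"] by (simp_all add: algebra_simps)
  then show ?thesis
    using u_lim[OF t, of "x + 1"] u_lim[OF t, of x] pv_lim_unique by simp
qed

lemma P_shift:
  assumes t: "0 \<le> t" shows "P (x + 1) t = P x t + P 1 t"
proof -
  have "((\<lambda>y. P (y + 1) t - P y t) has_real_derivative 0) (at y)" for y
    using \<rho>_periodic[OF t, of y]
    by (auto intro!: derivative_eq_intros DERIV_chain2[OF P_deriv[OF t]])
  then have "P (x + 1) t - P x t = P (0 + 1) t - P 0 t"
    using DERIV_isconst_all[of "\<lambda>y. P (y + 1) t - P y t"] by blast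
  then show ?thesis using P_0 by simp
qed

text \<open>\<open>P 1 t\<close> is the mass of one period, and the fluxes at 0 and 1 agree by
  periodicity.\<close>

lemma mass_conserved:
  assumes "0 \<le> t" shows "P 1 t = P 1 0"
proof (cases "t = 0")
  case False
  have "continuous_on {0..t} (\<lambda>s. P 1 s)"
    using assms by (intro P_cont_comp continuous_intros) auto
  moreover have "((\<lambda>s. P 1 s) has_real_derivative 0) (at s)" if "0 < s" for s
    using P_time_deriv[OF that, of 1] \<rho>_periodic[of s 0] u_periodic[of s 0] that by simp
  ultimately show ?thesis
    using DERIV_isconst_end[of 0 t "\<lambda>s. P 1 s"] assms False by auto
qed simp

subsection \<open>Comparison of two solutions\<close>

text \<open>At an interior negative minimum of \<open>P y - P x\<close>, \<open>x \<le> y \<le> x + 1\<close>, the density vanishes at both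
  ends, hence so does the flux, whatever the velocity is.\<close>

lemma \<rho>_nonneg:
  assumes mass: "0 < P 1 0" and init: "\<And>x. 0 \<le> \<rho> x 0" and t: "0 \<le> t"
  shows "0 \<le> \<rho> x t"
proof -
  \<comment> \<open>\<open>W (y, l) s\<close> is the mass of [y, y + l]. Periodicity in
    \<open>y\<close> reduces the minimisation to a compact square.\<close>
  define W where "W = (\<lambda>(y, l) s. P (y + l) s - P y s)"
  have W_frac: "W (frac y, l) s = W (y, l) s" if "0 \<le> s" for y l s
  proof (rule periodic_frac)
    show "W (y + 1, l) s = W (y, l) s" for y
      using P_shift[OF that, of "y + l"] P_shift[OF that, of y] by (simp add: W_def algebra_simps)
  qed
  have W_nonneg: "0 \<le> W p s" if "p \<in> {0..1} \<times> {0..1}" "0 \<le> s" for p s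
  proof (rule minimum_principle[where K = "{0..1} \<times> {0..1}", OF _ _ _ _ that])
    show "compact ({0..1::real} \<times> {0..1::real})" by (simp add: compact_Times)
    show "continuous_on (({0..1} \<times> {0..1}) \<times> {0..}) (\<lambda>(p, t). W p t)"
      unfolding W_def case_prod_unfold by (intro continuous_intros P_cont_comp) auto
    show "0 \<le> W p 0" if "p \<in> {0..1} \<times> {0..1}" for p
      using that DERIV_nonneg_imp_nondecreasing[of "fst p" "fst p + snd p" "\<lambda>y. P y 0"] P_deriv init
      by (fastforce simp: W_def)
  next
    fix p s assume p: "p \<in> {0..1} \<times> {0..1}" and s: "0 < s" and neg: "W p s < 0"
      and min: "\<And>q. q \<in> {0..1} \<times> {0..1} \<Longrightarrow> W p s \<le> W q s"
    obtain y l where p_eq: "p = (y, l)" by force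
    have min': "W (y, l) s \<le> W (y', l') s" if "l' \<in> {0..1}" for y' l'
      using min[of "(frac y', l')"] that W_frac[of s y' l'] s p_eq
      by (auto intro: less_imp_le[OF frac_lt_1])
    have "l \<noteq> 0" using neg by (auto simp: W_def p_eq)
    moreover have "l \<noteq> 1"
      using neg mass mass_conserved[of s] P_shift[of s y] s by (auto simp: W_def p_eq)
    ultimately have l: "0 < l" "l < 1" using p p_eq by auto
    \<comment> \<open>Translating the interval equates the densities at its ends; moving the right
      end alone then makes them zero.\<close>
    have "((\<lambda>y. W (y, l) s) has_real_derivative \<rho> (y + l) s - \<rho> y s) (at y)"
      using s by (auto simp: W_def intro!: derivative_eq_intros DERIV_chain2[OF P_deriv])
    then have eq: "\<rho> (y + l) s - \<rho> y s = 0"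
      by (rule DERIV_local_min[of _ _ _ 1]) (use min' l in auto)
    have "((\<lambda>l. W (y, l) s) has_real_derivative \<rho> (y + l) s) (at l)"
      using s by (auto simp: W_def intro!: derivative_eq_intros DERIV_chain2[OF P_deriv])
    then have "\<rho> (y + l) s = 0"
      by (rule DERIV_local_min[of _ _ _ "min l (1 - l)"]) (use l in \<open>auto intro!: min'\<close>)
    with eq have "((\<lambda>s. W p s) has_real_derivative 0) (at s)"
      using P_time_deriv[OF s, of "y + l"] P_time_deriv[OF s, of y]
      by (auto simp: W_def p_eq intro!: derivative_eq_intros)
    then show "\<exists>d\<ge>0. ((\<lambda>s. W p s) has_real_derivative d) (at s)" by blast
  qed
  show ?thesis
  proof (rule ccontr)
    assume "\<not> 0 \<le> \<rho> x t"
    then obtain d where d: "d > 0" "\<And>h. 0 < h \<Longrightarrow> h < d \<Longrightarrow> P (x + h) t < P x t"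
      using DERIV_neg_dec_right[OF P_deriv[OF t, of x]] by auto
    define h where "h = min (d / 2) 1"
    have h: "0 < h" "h < d" "h \<le> 1" using d(1) by (auto simp: h_def)
    have "0 \<le> W (frac x, h) t"
      using h t by (intro W_nonneg) (auto intro: less_imp_le[OF frac_lt_1])
    then have "P x t \<le> P (x + h) t" using W_frac[OF t, of x h] by (simp add: W_def)
    with d(2)[of h] h show False by simp
  qed
qed

text \<open>Subtracting \<open>P h t\<close> restores the normalisation at 0; its time derivative
  supplies the flux at \<open>h\<close>, which is the flux of the translated solution at 0.\<close>

lemma transport_shift: "transport a c (\<lambda>x t. P (x + h) t - P h t) (\<lambda>x t. \<rho> (x + h) t) (\<lambda>x t. u (x + h) t)"
proof
  show "continuous_on (UNIV \<times> {0..}) (\<lambda>(x, t). P (x + h) t - P h t)"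
    unfolding case_prod_unfold by (intro continuous_intros P_cont_comp) auto
  show "((\<lambda>y. P (y + h) t - P h t) has_real_derivative \<rho> (x + h) t) (at x)" if "0 \<le> t" for x t
    by (auto intro!: derivative_eq_intros DERIV_chain2[OF P_deriv[OF that]])
  show "((\<lambda>s. P (x + h) s - P h s) has_real_derivative
      c * (\<rho> (0 + h) t * u (0 + h) t - \<rho> (x + h) t * u (x + h) t)) (at t)" if "0 < t" for x t
    using P_time_deriv[OF that, of "x + h"] P_time_deriv[OF that, of h]
    by (auto simp: algebra_simps intro!: derivative_eq_intros)
  show "\<rho> (x + 1 + h) t = \<rho> (x + h) t" if "0 \<le> t" for x t
    using \<rho>_periodic[OF that, of "x + h"] by (simp add: algebra_simps)
  show "(\<lambda>y. \<rho> (y + h) t) differentiable (at x)" if "0 \<le> t" for x t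
    using \<rho>_differentiable[OF that, of "x + h"]
    by (auto simp: real_differentiable_def DERIV_shift)
  show "pv_lim a (\<lambda>z. \<rho> (x - z + h) t - \<rho> (x + z + h) t) (u (x + h) t)" if "0 \<le> t" for x t
    using u_lim[OF that, of "x + h"] by (simp add: algebra_simps)
qed (use a_pos a_less c_pos in \<open>simp_all\<close>)

text \<open>Reflection exchanges x - z and x + z, so the velocity changes sign; the minus sign in
  the primitive compensates for the chain rule and keeps the density nonreversed in sign.\<close>

lemma transport_reflect: "transport a c (\<lambda>x t. - P (- x) t) (\<lambda>x t. \<rho> (- x) t) (\<lambda>x t. - u (- x) t)"
proof
  show "continuous_on (UNIV \<times> {0..}) (\<lambda>(x, t). - P (- x) t)"
    unfolding case_prod_unfold by (intro continuous_intros P_cont_comp) auto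
  show "((\<lambda>y. - P (- y) t) has_real_derivative \<rho> (- x) t) (at x)" if "0 \<le> t" for x t
    using P_deriv[OF that, of "- x"] by (auto intro!: derivative_eq_intros DERIV_mirror[THEN iffD1])
  show "((\<lambda>s. - P (- x) s) has_real_derivative
      c * (\<rho> (- 0) t * - u (- 0) t - \<rho> (- x) t * - u (- x) t)) (at t)" if "0 < t" for x t
    using P_time_deriv[OF that, of "- x"]
    by (auto simp: algebra_simps intro!: derivative_eq_intros)
  show "\<rho> (- (x + 1)) t = \<rho> (- x) t" if "0 \<le> t" for x t
    using \<rho>_periodic[OF that, of "- (x + 1)"] by simp
  show "(\<lambda>y. \<rho> (- y) t) differentiable (at x)" if "0 \<le> t" for x t
    using \<rho>_differentiable[OF that, of "- x"] by (auto simp: real_differentiable_def DERIV_mirror)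
  show "pv_lim a (\<lambda>z. \<rho> (- (x - z)) t - \<rho> (- (x + z)) t) (- u (- x) t)" if "0 \<le> t" for x t
  proof -
    have "continuous_on UNIV (\<lambda>z. \<rho> (- x - z) t - \<rho> (- x + z) t)"
      using that by (intro continuous_intros \<rho>_cont_comp)
    \<comment> \<open>Negation is written as 1 - 2, since \<open>pv_lim_lincomb\<close> gives its
      first term the coefficient 1.\<close>
    then have "pv_lim a (\<lambda>z. \<rho> (- x - z) t - \<rho> (- x + z) t + (- 2) * (\<rho> (- x - z) t - \<rho> (- x + z) t))
        (u (- x) t + (- 2) * u (- x) t)"
      by (intro pv_lim_lincomb u_lim that)
    moreover have "- (x - z) = - x + z" "- (x + z) = - x - z" for z by simp_all
    ultimately show ?thesis by simp
  qed
qed (use a_pos a_less c_pos P_0 in \<open>simp_all\<close>)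

end

text \<open>For D the difference of the primitives, 2 D(x) - D(x - z) - D(x + z) is an
  antiderivative in z of the density difference that determines the difference of velocities. A
  minimum of D at x makes it nonpositive, and one integration by parts, with gap 0,
  concludes.\<close>

lemma velocity_le_at_min:
  assumes tr1: "transport a c P\<^sub>1 \<rho>\<^sub>1 u\<^sub>1" and tr2: "transport a c P\<^sub>2 \<rho>\<^sub>2 u\<^sub>2" and t: "0 \<le> t"
    and min: "\<And>y. P\<^sub>1 x t - P\<^sub>2 x t \<le> P\<^sub>1 y t - P\<^sub>2 y t"
  shows "u\<^sub>1 x t \<le> u\<^sub>2 x t"
proof -
  interpret tr1: transport a c P\<^sub>1 \<rho>\<^sub>1 u\<^sub>1 by fact
  interpret tr2: transport a c P\<^sub>2 \<rho>\<^sub>2 u\<^sub>2 by fact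
  define q where "q z = (\<rho>\<^sub>1 (x - z) t - \<rho>\<^sub>1 (x + z) t) + (-1) * (\<rho>\<^sub>2 (x - z) t - \<rho>\<^sub>2 (x + z) t)" for z
  define D where "D y = P\<^sub>1 y t - P\<^sub>2 y t" for y
  define Q where "Q z = 2 * D x - D (x - z) - D (x + z)" for z
  have D: "(D has_real_derivative \<rho>\<^sub>1 y t - \<rho>\<^sub>2 y t) (at y)" for y
    unfolding D_def using t by (intro DERIV_diff tr1.P_deriv tr2.P_deriv)
  have "u\<^sub>1 x t + (-1) * u\<^sub>2 x t \<le> - (a * 0 * (1 - 1))"
  proof (rule pv_lim_by_parts[where q = q and Q = Q])
    show "pv_lim a q (u\<^sub>1 x t + (-1) * u\<^sub>2 x t)"
      unfolding q_def using t
      by (intro pv_lim_lincomb tr1.u_lim tr2.u_lim continuous_intros tr1.\<rho>_cont_comp tr2.\<rho>_cont_comp)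
    show "(Q has_real_derivative q z) (at z)" for z
      unfolding Q_def q_def
      by (auto intro!: derivative_eq_intros DERIV_chain2[OF D])
    show "continuous_on UNIV q"
      unfolding q_def using t
      by (intro continuous_intros tr1.\<rho>_cont_comp tr2.\<rho>_cont_comp)
    have "(\<lambda>z. \<rho> (x + s * z) t) differentiable (at 0)" if "(\<lambda>y. \<rho> y t) differentiable (at x)"
      for \<rho> :: "real \<Rightarrow> real \<Rightarrow> real" and s
      using that differentiable_chain_at[of "\<lambda>z. x + s * z" 0 "\<lambda>y. \<rho> y t"]
      by (simp add: comp_def)
    note diff = this[where s = 1, simplified] this[where s = "-1", simplified]
    show "q differentiable (at 0)"
      unfolding q_def using t
      by (intro derivative_intros diff tr1.\<rho>_differentiable tr2.\<rho>_differentiable)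
    show Q_le: "Q z \<le> 0" for z using min[of "x - z"] min[of "x + z"] by (simp add: Q_def D_def)
    show "Q z \<le> - 0" for z using Q_le by simp
  qed (use tr1.a_pos tr1.a_less in \<open>auto simp: Q_def q_def D_def\<close>)
  then show ?thesis by simp
qed

text \<open>Equal masses make the difference D of the primitives periodic. A pair (y, z) minimising
  D(y) - D(z) is a minimum and a maximum of D: the densities agree at each point, and
  \<open>velocity_le_at_min\<close> orders the velocities in opposite senses. Nonnegative density
  turns this into a nonnegative time derivative.\<close>

lemma oscillation_comparison:
  assumes tr1: "transport a c P\<^sub>1 \<rho>\<^sub>1 u\<^sub>1" and tr2: "transport a c P\<^sub>2 \<rho>\<^sub>2 u\<^sub>2" and t: "0 \<le> t"
    and nonneg: "\<And>x t. 0 \<le> t \<Longrightarrow> 0 \<le> \<rho>\<^sub>1 x t" and mass: "P\<^sub>1 1 0 = P\<^sub>2 1 0"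
    and init: "\<And>x y. M \<le> (P\<^sub>1 x 0 - P\<^sub>2 x 0) - (P\<^sub>1 y 0 - P\<^sub>2 y 0)"
  shows "M \<le> (P\<^sub>1 x t - P\<^sub>2 x t) - (P\<^sub>1 y t - P\<^sub>2 y t)"
proof -
  interpret tr1: transport a c P\<^sub>1 \<rho>\<^sub>1 u\<^sub>1 by fact
  interpret tr2: transport a c P\<^sub>2 \<rho>\<^sub>2 u\<^sub>2 by fact
  define D where "D y s = P\<^sub>1 y s - P\<^sub>2 y s" for y s
  have D_frac: "D (frac y) s = D y s" if "0 \<le> s" for y s
    using tr1.P_shift[OF that] tr2.P_shift[OF that] tr1.mass_conserved[OF that]
      tr2.mass_conserved[OF that] mass
    by (intro periodic_frac) (simp add: D_def)
  have frac_in: "frac z \<in> {0..1}" for z :: real by (auto intro: less_imp_le[OF frac_lt_1])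
  define W where "W = (\<lambda>(y, z) s. D y s - D z s)"
  have "M \<le> W (frac x, frac y) t"
  proof (rule minimum_principle[where K = "{0..1} \<times> {0..1}", OF _ _ _ _ _ t])
    show "compact ({0..1::real} \<times> {0..1::real})" by (simp add: compact_Times)
    show "continuous_on (({0..1} \<times> {0..1}) \<times> {0..}) (\<lambda>(p, t). W p t)"
      unfolding W_def D_def case_prod_unfold
      by (intro continuous_intros tr1.P_cont_comp tr2.P_cont_comp) auto
    show "M \<le> W p 0" for p using init by (auto simp: W_def D_def split: prod.split)
    show "(frac x, frac y) \<in> {0..1} \<times> {0..1}" using frac_in by blast
  next
    fix p s assume p: "p \<in> {0..1} \<times> {0..1}" and s: "0 < s"
      and min: "\<And>q. q \<in> {0..1} \<times> {0..1} \<Longrightarrow> W p s \<le> W q s"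
    obtain y z where p_eq: "p = (y, z)" by force
    have min': "D y s \<le> D w s" and max': "D w s \<le> D z s" for w
      using min[of "(frac w, z)"] min[of "(y, frac w)"] p D_frac[of s w] frac_in[of w] s
      by (auto simp: W_def p_eq)
    have D: "((\<lambda>y. D y s) has_real_derivative \<rho>\<^sub>1 w s - \<rho>\<^sub>2 w s) (at w)" for w
      unfolding D_def using s by (intro DERIV_diff tr1.P_deriv tr2.P_deriv) auto
    have "\<rho>\<^sub>1 y s - \<rho>\<^sub>2 y s = 0"
      by (rule DERIV_local_min[OF D, of 1]) (use min' in auto)
    moreover have "\<rho>\<^sub>1 z s - \<rho>\<^sub>2 z s = 0"
      by (rule DERIV_local_max[OF D, of 1]) (use max' in auto)
    ultimately have eq: "\<rho>\<^sub>2 y s = \<rho>\<^sub>1 y s" "\<rho>\<^sub>2 z s = \<rho>\<^sub>1 z s" by auto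
    have "u\<^sub>1 y s \<le> u\<^sub>2 y s"
      using min' s by (intro velocity_le_at_min[OF tr1 tr2]) (auto simp: D_def)
    then have 1: "0 \<le> \<rho>\<^sub>1 y s * (u\<^sub>2 y s - u\<^sub>1 y s)"
      using nonneg[of s y] s by simp
    have "u\<^sub>2 z s \<le> u\<^sub>1 z s"
      using max' s by (intro velocity_le_at_min[OF tr2 tr1]) (auto simp: D_def algebra_simps)
    then have 2: "0 \<le> \<rho>\<^sub>1 z s * (u\<^sub>1 z s - u\<^sub>2 z s)"
      using nonneg[of s z] s by simp
    \<comment> \<open>The fluxes at 0 cancel between y and z; replacing
      \<open>\<rho>\<^sub>2\<close> by \<open>\<rho>\<^sub>1\<close> leaves only velocity
      differences.\<close>
    have "((\<lambda>s. W p s) has_real_derivative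
        c * (\<rho>\<^sub>1 y s * (u\<^sub>2 y s - u\<^sub>1 y s) + \<rho>\<^sub>1 z s * (u\<^sub>1 z s - u\<^sub>2 z s))) (at s)"
      unfolding W_def D_def p_eq case_prod_conv
      by (auto intro!: derivative_eq_intros tr1.P_time_deriv[OF s] tr2.P_time_deriv[OF s]
          simp: eq algebra_simps)
    with 1 2 tr1.c_pos show "\<exists>d\<ge>0. ((\<lambda>s. W p s) has_real_derivative d) (at s)"
      by (intro exI conjI) auto
  qed
  then show ?thesis using D_frac[OF t] by (simp add: W_def D_def)
qed

subsection \<open>Preservation of symmetry, bounds and monotonicity\<close>

text \<open>This provides the sign of the third antiderivative in
  \<open>pv_lim_by_parts_thrice\<close>. An odd \<open>f\<close> may fall below \<open>f x\<close>
  outside [0, 1/2], so values of \<open>f\<close> cannot be compared directly. Increments of the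
  even function \<open>F\<close> can: their endpoints fold into [0, 1/2], where the minimum applies.
  One more integration gives the quadratic bound.\<close>

lemma second_difference_lower_bound:
  fixes f F H :: "real \<Rightarrow> real"
  assumes odd: "\<And>y. f (- y) = - f y" and per: "\<And>y. f (y + 1) = f y"
    and F: "\<And>y. (F has_real_derivative f y) (at y)" and H: "\<And>y. (H has_real_derivative F y) (at y)"
    and x: "0 \<le> x" "x \<le> 1/2" and neg: "f x \<le> 0"
    and min: "\<And>y. 0 \<le> y \<Longrightarrow> y \<le> 1/2 \<Longrightarrow> f x \<le> f y" and z: "0 \<le> z"
  shows "z\<^sup>2 * f x \<le> H (x + z) + H (x - z) - 2 * H x"
proof -
  have F_even: "F (- y) = F y" for y
  proof -
    have "((\<lambda>y. F (- y) - F y) has_real_derivative 0) (at w)" for w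
      by (auto intro!: derivative_eq_intros DERIV_chain2[OF F] simp: odd)
    then have "F (- y) - F y = F (- 0) - F 0"
      using DERIV_isconst_all[of "\<lambda>y. F (- y) - F y"] by blast
    then show ?thesis by simp
  qed
  have F_per: "F (y + 1) = F y" for y
  proof -
    have "((\<lambda>y. F (y + 1) - F y) has_real_derivative 0) (at w)" for w
      by (auto intro!: derivative_eq_intros DERIV_chain2[OF F] simp: per)
    then have "F (y + 1) - F y = F (- (1/2) + 1) - F (- (1/2))"
      using DERIV_isconst_all[of "\<lambda>y. F (y + 1) - F y"] by blast
    also have "\<dots> = 0" using F_even[of "1/2"] by simp
    finally show ?thesis by simp
  qed
  have F_incr: "2 * w * f x \<le> F p - F q" if "0 \<le> q" "q \<le> p" "p \<le> 1/2" "p - q \<le> 2 * w" for p q w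
  proof (cases "p = q")
    case True
    with that neg show ?thesis by (simp add: mult_nonneg_nonpos)
  next
    case False
    with \<open>q \<le> p\<close> have "q < p" by simp
    then obtain \<xi> where "q < \<xi>" "\<xi> < p" "F p - F q = (p - q) * f \<xi>"
      using MVT2[of q p F f] F by blast
    moreover have "(p - q) * f x \<le> (p - q) * f \<xi>"
      using that calculation min by (intro mult_left_mono) auto
    moreover have "2 * w * f x \<le> (p - q) * f x"
      using that neg by (intro mult_right_mono_neg) auto
    ultimately show ?thesis by linarith
  qed
  define S where "S w = F (x + w) - F (x - w)" for w
  define T where "T w = H (x + w) + H (x - w) - 2 * H x" for w
  have T: "(T has_real_derivative S w) (at w)" for w
    unfolding T_def S_def by (auto intro!: derivative_eq_intros DERIV_chain2[OF H])
  \<comment> \<open>Reflections at 0 and 1/2 preserve \<open>F\<close> and bring x - w and x + w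
    into [0, 1/2], in the same order and at distance at most 2 w.\<close>
  have S_ge: "2 * w * f x \<le> S w" if w: "0 \<le> w" "w \<le> 1/2" for w
  proof -
    have 1: "F (x - w) = F \<bar>x - w\<bar>" using F_even[of "x - w"] by (simp add: abs_if)
    have "F (x + w) = F (- (x + w) + 1)" using F_even[of "x + w"] F_per[of "- (x + w)"] by simp
    then have 2: "F (x + w) = F (if x + w \<le> 1/2 then x + w else 1 - x - w)"
      by (simp add: algebra_simps)
    show ?thesis
      unfolding S_def 1 2 using x w by (intro F_incr) (auto simp: abs_if)
  qed
  have T_half: "w\<^sup>2 * f x \<le> T w" if w: "0 \<le> w" "w \<le> 1/2" for w
  proof -
    have "T 0 - 0\<^sup>2 * f x \<le> T w - w\<^sup>2 * f x"
    proof (rule DERIV_nonneg_imp_nondecreasing[OF w(1)])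
      fix y assume "0 \<le> y" "y \<le> w"
      moreover have "((\<lambda>w. T w - w\<^sup>2 * f x) has_real_derivative S y - 2 * y * f x) (at y)"
        by (auto intro!: derivative_eq_intros T)
      ultimately show "\<exists>d. ((\<lambda>w. T w - w\<^sup>2 * f x) has_real_derivative d) (at y) \<and> 0 \<le> d"
        using S_ge[of y] w by auto
    qed
    then show ?thesis by (simp add: T_def)
  qed
  have T_refl: "T (1 - w) = T w" for w
  proof -
    have "S (1 - y) = - S y" for y
      using F_per[of "x - y"] F_per[of "x + y - 1"] by (simp add: S_def algebra_simps)
    then have "((\<lambda>w. T (1 - w) - T w) has_real_derivative 0) (at y)" for y
      by (auto intro!: derivative_eq_intros DERIV_chain2[OF T])
    then have "T (1 - w) - T w = T (1 - 1/2) - T (1/2)"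
      using DERIV_isconst_all[of "\<lambda>w. T (1 - w) - T w"] by blast
    then show ?thesis by simp
  qed
  have "T (w + 1) = T w" for w
    using T_refl[of "- w"] by (simp add: T_def algebra_simps)
  then have T_frac: "T (frac z) = T z" by (rule periodic_frac)
  \<comment> \<open>The distance from \<open>z\<close> to the nearest integer: \<open>T\<close>
    takes the same value there, and w \<le> z with f x \<le> 0 makes the bound at \<open>w\<close>
    the stronger one.\<close>
  define w where "w = (if frac z \<le> 1/2 then frac z else 1 - frac z)"
  have "frac z \<le> z" using z by (simp add: frac_def)
  then have w: "0 \<le> w" "w \<le> 1/2" "w \<le> z"
    using frac_lt_1[of z] frac_ge_0[of z] by (auto simp: w_def)
  have "z\<^sup>2 * f x \<le> w\<^sup>2 * f x"
    using w neg by (intro mult_right_mono_neg power_mono) auto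
  also have "\<dots> \<le> T w" using w by (intro T_half)
  also have "\<dots> = T z" using T_frac T_refl[of "frac z"] by (simp add: w_def)
  finally show ?thesis by (simp add: T_def)
qed

text \<open>Reflections at 0 and 1/2 bring both points into [0, 1/2] without reversing their
  order.\<close>

lemma even_periodic_fold_le:
  fixes r :: "real \<Rightarrow> real"
  assumes "\<And>y. r (- y) = r y" "\<And>y. r (y + 1) = r y"
    and mono: "\<And>p q. 0 \<le> p \<Longrightarrow> p \<le> q \<Longrightarrow> q \<le> 1/2 \<Longrightarrow> r p \<le> r q"
    and "0 \<le> x" "x \<le> 1/2" "0 \<le> z" "z \<le> 1/2"
  shows "r (x - z) \<le> r (x + z)"
proof -
  have 1: "r (x - z) = r \<bar>x - z\<bar>" using assms(1)[of "x - z"] by (simp add: abs_if)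
  have "r (x + z) = r (- (x + z) + 1)" using assms(1)[of "x + z"] assms(2)[of "- (x + z)"] by simp
  then have 2: "r (x + z) = r (if x + z \<le> 1/2 then x + z else 1 - x - z)"
    by (simp add: algebra_simps)
  show ?thesis
    unfolding 1 2 using assms(4-) by (intro mono) (auto simp: abs_if)
qed

lemma derivative_le_of_increment_le:
  fixes F G :: "real \<Rightarrow> real"
  assumes F: "(F has_real_derivative p) (at x)" and G: "(G has_real_derivative q) (at y)"
    and le: "\<And>h. 0 < h \<Longrightarrow> F (x + h) - F x \<le> G (y + h) - G y + k * h"
  shows "p \<le> q + k"
proof -
  have "((\<lambda>h. (F (x + h) - F x) / h) \<longlongrightarrow> p) (at_right 0)"
    "((\<lambda>h. (G (y + h) - G y) / h) \<longlongrightarrow> q) (at_right 0)"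
    using F G unfolding DERIV_def by (auto intro: tendsto_mono[OF at_le])
  then show ?thesis
  proof (intro tendsto_le[OF _ tendsto_add[OF _ tendsto_const[of k]]])
    show "eventually (\<lambda>h. (F (x + h) - F x) / h \<le> (G (y + h) - G y) / h + k) (at_right 0)"
      using eventually_at_right_less[of 0]
    proof eventually_elim
      case (elim h)
      then have "(F (x + h) - F x) / h \<le> (G (y + h) - G y + k * h) / h"
        using le by (intro divide_right_mono) auto
      with elim show ?case by (simp add: add_divide_distrib)
    qed
  qed auto
qed

context transport
begin

text \<open>The primitives of the solution and of its reflection agree at time 0. Comparison with
  bound 0, used for both orders of the two points, makes their difference constant in space, and it
  vanishes at 0.\<close>

lemma \<rho>_even:
  assumes nonneg: "\<And>x t. 0 \<le> t \<Longrightarrow> 0 \<le> \<rho> x t" and init: "\<And>x. \<rho> (- x) 0 = \<rho> x 0" and t: "0 \<le> t"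
  shows "\<rho> (- x) t = \<rho> x t" "P (- x) t = - P x t"
proof -
  have odd0: "P (- y) 0 = - P y 0" for y
  proof -
    have "((\<lambda>y. P (- y) 0 + P y 0) has_real_derivative 0) (at w)" for w
      by (auto intro!: derivative_eq_intros DERIV_chain2[OF P_deriv] simp: init)
    then have "P (- y) 0 + P y 0 = P (- 0) 0 + P 0 0"
      using DERIV_isconst_all[of "\<lambda>y. P (- y) 0 + P y 0"] by blast
    then show ?thesis using P_0 by simp
  qed
  have ge: "0 \<le> (P x t - - P (- x) t) - (P y t - - P (- y) t)" for x y
    by (rule oscillation_comparison[OF transport_axioms transport_reflect t nonneg])
      (simp_all add: odd0)
  have "P x t + P (- x) t = 0" for x
    using ge[of x 0] ge[of 0 x] P_0 by simp
  then show odd: "P (- x) t = - P x t" for x by (simp add: add_eq_0_iff)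
  have "((\<lambda>y. - P (- y) t) has_real_derivative \<rho> (- x) t) (at x)"
    by (auto intro!: derivative_eq_intros DERIV_chain2[OF P_deriv[OF t]])
  moreover have "(\<lambda>y. - P (- y) t) = (\<lambda>y. P y t)" using odd by auto
  ultimately show "\<rho> (- x) t = \<rho> x t"
    using DERIV_unique P_deriv[OF t, of x] by metis
qed

text \<open>Comparison with the translate by \<open>h\<close> controls the difference between the
  masses of two intervals of length \<open>h\<close>. Initially these lie between 0 and r h, so they
  never differ by more than r h; dividing by \<open>h\<close> bounds the oscillation of the density
  by \<open>r\<close>. By the mean value theorem the density equals \<open>P 1 0\<close>
  somewhere.\<close>

lemma \<rho>_le:
  assumes nonneg: "\<And>x t. 0 \<le> t \<Longrightarrow> 0 \<le> \<rho> x t" and init: "\<And>x. \<rho> x 0 \<le> r" and t: "0 \<le> t"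
  shows "\<rho> x t \<le> P 1 0 + r"
proof -
  have incr0: "0 \<le> P (y + h) 0 - P y 0" "P (y + h) 0 - P y 0 \<le> r * h" if h: "0 < h" for y h
  proof -
    obtain \<xi> where "P (y + h) 0 - P y 0 = h * \<rho> \<xi> 0"
      using MVT2[of y "y + h" "\<lambda>y. P y 0" "\<lambda>y. \<rho> y 0"] P_deriv[of 0] h by auto
    then show "0 \<le> P (y + h) 0 - P y 0" "P (y + h) 0 - P y 0 \<le> r * h"
      using h nonneg[of 0 \<xi>] init[of \<xi>] by (auto simp: mult.commute[of h] intro: mult_right_mono)
  qed
  have incr: "P (x + h) t - P x t \<le> P (y + h) t - P y t + r * h" if "0 < h" for y h
  proof -
    have "- (r * h) \<le> (P x t - (P (x + h) t - P h t)) - (P y t - (P (y + h) t - P h t))"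
    proof (rule oscillation_comparison[OF transport_axioms transport_shift t nonneg])
      show "P 1 0 = P (1 + h) 0 - P h 0" using P_shift[of 0 h] by (simp add: add.commute)
      show "- (r * h) \<le> P x 0 - (P (x + h) 0 - P h 0) - (P y 0 - (P (y + h) 0 - P h 0))" for x y
        using incr0[OF that, of x] incr0[OF that, of y] by simp
    qed
    then show ?thesis by simp
  qed
  obtain y where "P 1 t - P 0 t = (1 - 0) * \<rho> y t"
    using MVT2[of 0 1 "\<lambda>y. P y t" "\<lambda>y. \<rho> y t"] P_deriv[OF t] by auto
  then have y: "\<rho> y t = P 1 0" using P_0 mass_conserved[OF t] by simp
  have "\<rho> x t \<le> \<rho> y t + r"
    by (rule derivative_le_of_increment_le[OF P_deriv[OF t] P_deriv[OF t] incr])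
  with y show ?thesis by simp
qed

text \<open>The combination of velocities belongs to q(z) = p(x - z) - p(x + z) with p = f'. The
  \<open>Q\<close>, \<open>R\<close>, \<open>U\<close> given below are the successive
  antiderivatives of \<open>q\<close> vanishing at 0, and
  \<open>second_difference_lower_bound\<close> says that \<open>U\<close> is nonpositive.\<close>

lemma velocity_second_difference_nonpos:
  assumes t: "0 \<le> t" and even: "\<And>y. P (- y) t = - P y t" and x: "0 \<le> x" "x \<le> 1/2"
    and f: "\<And>y. f y = P (y + h) t + P (y - h) t - 2 * P y t"
    and neg: "f x \<le> 0" and min: "\<And>y. 0 \<le> y \<Longrightarrow> y \<le> 1/2 \<Longrightarrow> f x \<le> f y"
  shows "u (x + h) t + u (x - h) t - 2 * u x t \<le> 0"
proof -
  define p where "p y = \<rho> (y + h) t + \<rho> (y - h) t - 2 * \<rho> y t" for y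
  have f_deriv: "(f has_real_derivative p y) (at y)" for y
    unfolding f p_def by (auto intro!: derivative_eq_intros DERIV_chain2[OF P_deriv[OF t]])
  have f_cont: "continuous_on UNIV f"
    using f_deriv DERIV_isCont by (intro continuous_at_imp_continuous_on) blast
  have f_odd: "f (- y) = - f y" for y
    using even[of "y - h"] even[of "y + h"] even[of y] by (simp add: f)
  have f_per: "f (y + 1) = f y" for y
    using P_shift[OF t, of "y + h"] P_shift[OF t, of "y - h"] P_shift[OF t, of y]
    by (simp add: f algebra_simps)
  obtain B where B: "\<And>y. \<bar>f y\<bar> \<le> B" using periodic_bounded[OF f_per f_cont] by blast
  obtain F where F: "\<And>y. (F has_real_derivative f y) (at y)"
    using antiderivative_exists[OF f_cont] by blast
  have "continuous_on UNIV F"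
    using F DERIV_isCont by (intro continuous_at_imp_continuous_on) blast
  then obtain H where H: "\<And>y. (H has_real_derivative F y) (at y)"
    using antiderivative_exists by blast
  define q where "q z = (\<rho> (x + h - z) t - \<rho> (x + h + z) t + 1 * (\<rho> (x - h - z) t - \<rho> (x - h + z) t))
      + (-2) * (\<rho> (x - z) t - \<rho> (x + z) t)" for z
  have q_eq: "q z = p (x - z) - p (x + z)" for z
    by (simp add: q_def p_def algebra_simps)
  have "(u (x + h) t + 1 * u (x - h) t) + (-2) * u x t \<le> 0"
  proof (rule pv_lim_by_parts_thrice[OF a_pos a_less, where q = q and B = "4 * B"
        and Q = "\<lambda>z. 2 * f x - f (x - z) - f (x + z)"
        and R = "\<lambda>z. 2 * z * f x + F (x - z) - F (x + z)"
        and U = "\<lambda>z. z\<^sup>2 * f x - H (x - z) - H (x + z) + 2 * H x"])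
    show "pv_lim a q (u (x + h) t + 1 * u (x - h) t + (-2) * u x t)"
      unfolding q_def using t
      by (intro pv_lim_lincomb u_lim continuous_intros \<rho>_cont_comp)
    show q_cont: "continuous_on UNIV q"
      unfolding q_def using t by (intro continuous_intros \<rho>_cont_comp)
    have "(\<lambda>z. \<rho> (y + s * z) t) differentiable (at 0)" for y s
      using \<rho>_differentiable[OF t] differentiable_chain_at[of "\<lambda>z. y + s * z" 0 "\<lambda>y. \<rho> y t"]
      by (simp add: comp_def)
    note diff = this[where s = 1, simplified] this[where s = "-1", simplified]
    show "q differentiable (at 0)"
      unfolding q_def by (intro derivative_intros diff)
    show "\<bar>2 * f x - f (x - z) - f (x + z)\<bar> \<le> 4 * B" for z
      using B[of x] B[of "x - z"] B[of "x + z"] by linarith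
    show "z\<^sup>2 * f x - H (x - z) - H (x + z) + 2 * H x \<le> 0" if "0 \<le> z" for z
      using second_difference_lower_bound[OF f_odd f_per F H x neg min that] by simp
  qed (auto simp: q_eq power2_eq_square intro!: derivative_eq_intros DERIV_chain2[OF f_deriv] DERIV_chain2[OF F] DERIV_chain2[OF H])
  then show ?thesis by simp
qed

text \<open>A negative minimum over positions and steps avoids the edges where the second difference
  vanishes. Stationarity in both variables equates the densities at the three points, so the time
  derivative is a nonnegative density times a velocity combination of known sign.\<close>

lemma second_difference_nonneg:
  assumes nonneg: "\<And>x t. 0 \<le> t \<Longrightarrow> 0 \<le> \<rho> x t" and even0: "\<And>x. \<rho> (- x) 0 = \<rho> x 0"
    and mono0: "\<And>p q. 0 \<le> p \<Longrightarrow> p \<le> q \<Longrightarrow> q \<le> 1/2 \<Longrightarrow> \<rho> p 0 \<le> \<rho> q 0" and t: "0 \<le> t"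
    and x: "0 \<le> x" "x \<le> 1/2" and h: "0 \<le> h" "h \<le> 1/2"
  shows "0 \<le> P (x + h) t + P (x - h) t - 2 * P x t"
proof -
  define W where "W = (\<lambda>(x, h) s. P (x + h) s + P (x - h) s - 2 * P x s)"
  define K :: "(real \<times> real) set" where "K = {0..1/2} \<times> {0..1/2}"
  have odd: "P (- y) s = - P y s" if "0 \<le> s" for y s
    by (rule \<rho>_even(2)) (use nonneg even0 that in auto)
  have "0 \<le> W (x, h) t"
  proof (rule minimum_principle[where K = K, OF _ _ _ _ _ t])
    show "compact K" by (simp add: K_def compact_Times)
    show "(x, h) \<in> K" using x h by (simp add: K_def)
    show "continuous_on (K \<times> {0..}) (\<lambda>(p, t). W p t)"
      unfolding W_def case_prod_unfold by (intro continuous_intros P_cont_comp) auto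
    show "0 \<le> W p 0" if "p \<in> K" for p
    proof -
      obtain y l where "p = (y, l)" by force
      with \<open>p \<in> K\<close> have p: "p = (y, l)" "0 \<le> y" "y \<le> 1/2" "0 \<le> l" "l \<le> 1/2"
        by (auto simp: K_def)
      have "W (y, 0) 0 \<le> W (y, l) 0"
      proof (rule DERIV_nonneg_imp_nondecreasing[OF p(4)])
        fix z assume z: "0 \<le> z" "z \<le> l"
        have "\<rho> (y - z) 0 \<le> \<rho> (y + z) 0"
          using p z by (intro even_periodic_fold_le[of "\<lambda>y. \<rho> y 0"] even0 \<rho>_periodic mono0) auto
        moreover have "((\<lambda>l. W (y, l) 0) has_real_derivative \<rho> (y + z) 0 - \<rho> (y - z) 0) (at z)"
          by (auto simp: W_def intro!: derivative_eq_intros DERIV_chain2[OF P_deriv])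
        ultimately show "\<exists>d. ((\<lambda>l. W (y, l) 0) has_real_derivative d) (at z) \<and> 0 \<le> d"
          by (intro exI conjI) auto
      qed
      then show ?thesis by (simp add: p W_def)
    qed
  next
    fix p s assume p: "p \<in> K" and s: "0 < s" and neg: "W p s < 0"
      and min: "\<And>q. q \<in> K \<Longrightarrow> W p s \<le> W q s"
    then have s': "0 \<le> s" by simp
    obtain y l where p_eq: "p = (y, l)" and y: "0 \<le> y" "y \<le> 1/2" and l: "0 \<le> l" "l \<le> 1/2"
      using p by (auto simp: K_def)
    have min': "W (y, l) s \<le> W (y', l') s" if "0 \<le> y'" "y' \<le> 1/2" "0 \<le> l'" "l' \<le> 1/2" for y' l'
      using min[of "(y', l')"] that by (simp add: K_def p_eq)
    \<comment> \<open>The primitive is odd about 0 and, up to the constant mass, about 1/2, so the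
      second difference is 0 at both positions.\<close>
    have "y \<noteq> 0" using neg odd[OF s', of l] P_0 by (auto simp: W_def p_eq)
    moreover have "y \<noteq> 1/2"
    proof
      assume y: "y = 1/2"
      have "P (1/2) s = - P (1/2) s + P 1 s"
        using P_shift[OF s', of "- (1/2)"] odd[OF s', of "1/2"] by simp
      moreover have "P (1/2 + l) s = - P (1/2 - l) s + P 1 s"
        using P_shift[OF s', of "- (1/2 - l)"] odd[OF s', of "1/2 - l"] by (simp add: add.commute)
      ultimately show False using neg unfolding W_def p_eq case_prod_conv y by simp
    qed
    ultimately have y': "0 < y" "y < 1/2" using y by auto
    have "l \<noteq> 0" using neg by (auto simp: W_def p_eq)
    have dy: "((\<lambda>y. W (y, l) s) has_real_derivative \<rho> (y + l) s + \<rho> (y - l) s - 2 * \<rho> y s) (at y)"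
      by (auto simp: W_def intro!: derivative_eq_intros DERIV_chain2[OF P_deriv[OF s']])
    have eq1: "\<rho> (y + l) s + \<rho> (y - l) s - 2 * \<rho> y s = 0"
      by (rule DERIV_local_min[OF dy, of "min y (1/2 - y)"]) (use y' l in \<open>auto intro!: min'\<close>)
    have dl: "((\<lambda>l. W (y, l) s) has_real_derivative \<rho> (y + l) s - \<rho> (y - l) s) (at l)"
      by (auto simp: W_def intro!: derivative_eq_intros DERIV_chain2[OF P_deriv[OF s']])
    have eq2: "\<rho> (y + l) s - \<rho> (y - l) s = 0"
    proof (cases "l = 1/2")
      \<comment> \<open>At this edge the minimum in \<open>l\<close> is only one-sided, but y - l
        and y + l differ by exactly one period.\<close>
      case True
      then have "y - l + 1 = y + l" by simp
      then show ?thesis using \<rho>_periodic[OF s', of "y - l"] by (simp only:)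
    next
      case False
      show ?thesis
        by (rule DERIV_local_min[OF dl, of "min l (1/2 - l)"])
          (use y l False \<open>l \<noteq> 0\<close> in \<open>auto intro!: min'\<close>)
    qed
    have eq: "\<rho> (y + l) s = \<rho> y s" "\<rho> (y - l) s = \<rho> y s" using eq1 eq2 by auto
    have "u (y + l) s + u (y - l) s - 2 * u y s \<le> 0"
      using neg y l min'
      by (intro velocity_second_difference_nonpos[where f = "\<lambda>y. W (y, l) s"] s' odd)
        (auto simp: W_def p_eq)
    then have "0 \<le> c * (\<rho> y s * (2 * u y s - u (y + l) s - u (y - l) s))"
      using nonneg[OF s', of y] c_pos by (intro mult_nonneg_nonneg) auto
    moreover have "((\<lambda>s. W p s) has_real_derivative
        c * (\<rho> 0 s * u 0 s - \<rho> (y + l) s * u (y + l) s) + c * (\<rho> 0 s * u 0 s - \<rho> (y - l) s * u (y - l) s)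
        - 2 * (c * (\<rho> 0 s * u 0 s - \<rho> y s * u y s))) (at s)"
      unfolding W_def p_eq case_prod_conv
      by (intro DERIV_add DERIV_diff DERIV_cmult P_time_deriv s)
    then have "((\<lambda>s. W p s) has_real_derivative
        c * (\<rho> y s * (2 * u y s - u (y + l) s - u (y - l) s))) (at s)"
      unfolding eq by (simp add: algebra_simps)
    ultimately show "\<exists>d\<ge>0. ((\<lambda>s. W p s) has_real_derivative d) (at s)" by blast
  qed
  then show ?thesis by (simp add: W_def)
qed

subsection \<open>The velocity estimate\<close>

lemma P_increment_ge:
  assumes t: "0 \<le> t" and "p \<le> q" "\<And>y. p \<le> y \<Longrightarrow> y \<le> q \<Longrightarrow> k \<le> \<rho> y t"
  shows "k * (q - p) \<le> P q t - P p t"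
proof -
  have "P p t - k * p \<le> P q t - k * q"
  proof (rule DERIV_nonneg_imp_nondecreasing[OF \<open>p \<le> q\<close>])
    fix y assume "p \<le> y" "y \<le> q"
    moreover have "((\<lambda>y. P y t - k * y) has_real_derivative \<rho> y t - k) (at y)"
      by (auto intro!: derivative_eq_intros DERIV_chain2[OF P_deriv[OF t]])
    ultimately show "\<exists>d. ((\<lambda>y. P y t - k * y) has_real_derivative d) (at y) \<and> 0 \<le> d"
      using assms(3) by (intro exI conjI) auto
  qed
  then show ?thesis by (simp add: algebra_simps)
qed

lemma P_increment_le:
  assumes t: "0 \<le> t" and "p \<le> q" "\<And>y. p \<le> y \<Longrightarrow> y \<le> q \<Longrightarrow> \<rho> y t \<le> k"
  shows "P q t - P p t \<le> k * (q - p)"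
proof -
  have "P q t - k * q \<le> P p t - k * p"
  proof (rule DERIV_nonpos_imp_nonincreasing[OF \<open>p \<le> q\<close>])
    fix y assume "p \<le> y" "y \<le> q"
    moreover have "((\<lambda>y. P y t - k * y) has_real_derivative \<rho> y t - k) (at y)"
      by (auto intro!: derivative_eq_intros DERIV_chain2[OF P_deriv[OF t]])
    ultimately show "\<exists>d. ((\<lambda>y. P y t - k * y) has_real_derivative d) (at y) \<and> d \<le> 0"
      using assms(3) by (intro exI conjI) auto
  qed
  then show ?thesis by (simp add: algebra_simps)
qed

text \<open>If the density dropped from p to q, subtracting a line of the mean slope would give a
  function rising at p and falling at q, hence maximal only inside. The second difference at a
  maximum, with the step reaching the nearer end, forces the maximal value at that end as
  well.\<close>

lemma \<rho>_mono:
  assumes t: "0 \<le> t"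
    and diff2: "\<And>x h. 0 \<le> x \<Longrightarrow> x \<le> 1/2 \<Longrightarrow> 0 \<le> h \<Longrightarrow> h \<le> 1/2 \<Longrightarrow> 0 \<le> P (x + h) t + P (x - h) t - 2 * P x t"
    and pq: "0 \<le> p" "p \<le> q" "q \<le> 1/2"
  shows "\<rho> p t \<le> \<rho> q t"
proof (rule ccontr)
  assume gt: "\<not> \<rho> p t \<le> \<rho> q t"
  then have "p < q" using pq by (cases "p = q") auto
  define s where "s = (\<rho> p t + \<rho> q t) / 2"
  define \<psi> where "\<psi> y = P y t - s * y" for y
  have \<psi>: "(\<psi> has_real_derivative \<rho> y t - s) (at y)" for y
    unfolding \<psi>_def by (auto intro!: derivative_eq_intros DERIV_chain2[OF P_deriv[OF t]])
  have not_p: "\<not> (\<forall>y\<in>{p..q}. \<psi> y \<le> \<psi> p)"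
  proof
    assume max: "\<forall>y\<in>{p..q}. \<psi> y \<le> \<psi> p"
    have "0 < \<rho> p t - s" using gt by (simp add: s_def)
    from DERIV_pos_inc_right[OF \<psi> this] obtain d where
      d: "d > 0" "\<And>h. 0 < h \<Longrightarrow> h < d \<Longrightarrow> \<psi> p < \<psi> (p + h)" by blast
    define h where "h = min (d / 2) (q - p)"
    have "0 < h" "h < d" "p + h \<in> {p..q}" using d(1) \<open>p < q\<close> by (auto simp: h_def)
    with d(2)[of h] max show False by fastforce
  qed
  have not_q: "\<not> (\<forall>y\<in>{p..q}. \<psi> y \<le> \<psi> q)"
  proof
    assume max: "\<forall>y\<in>{p..q}. \<psi> y \<le> \<psi> q"
    have "\<rho> q t - s < 0" using gt by (simp add: s_def)
    from DERIV_neg_dec_left[OF \<psi> this] obtain d where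
      d: "d > 0" "\<And>h. 0 < h \<Longrightarrow> h < d \<Longrightarrow> \<psi> q < \<psi> (q - h)" by blast
    define h where "h = min (d / 2) (q - p)"
    have "0 < h" "h < d" "q - h \<in> {p..q}" using d(1) \<open>p < q\<close> by (auto simp: h_def)
    with d(2)[of h] max show False by fastforce
  qed
  have "continuous_on {p..q} \<psi>"
    using \<psi> DERIV_isCont by (intro continuous_at_imp_continuous_on) blast
  then obtain \<xi> where \<xi>: "\<xi> \<in> {p..q}" "\<forall>y\<in>{p..q}. \<psi> y \<le> \<psi> \<xi>"
    using continuous_attains_sup[of "{p..q}" \<psi>] pq by auto
  define d where "d = min (\<xi> - p) (q - \<xi>)"
  have d: "0 \<le> d" "d \<le> 1/2" "\<xi> + d \<in> {p..q}" "\<xi> - d \<in> {p..q}" "\<xi> + d = q \<or> \<xi> - d = p"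
    using \<xi>(1) pq by (auto simp: d_def min_def)
  have "2 * \<psi> \<xi> \<le> \<psi> (\<xi> + d) + \<psi> (\<xi> - d)"
    using diff2[of \<xi> d] d \<xi>(1) pq by (simp add: \<psi>_def algebra_simps)
  with bspec[OF \<xi>(2) d(3)] bspec[OF \<xi>(2) d(4)]
  have "\<psi> (\<xi> + d) = \<psi> \<xi>" "\<psi> (\<xi> - d) = \<psi> \<xi>" by linarith+
  with d(5) \<xi>(2) not_p not_q show False by metis
qed

text \<open>The second difference \<open>E\<close> of the primitive is nonnegative everywhere, and a
  lower bound for it on [1/2 - \<epsilon>, 1/2] is the gap in \<open>pv_lim_by_parts\<close>.
  \<open>\<eta>\<close> is the radius about 1/2 within which the density is at least 3m/4;
  \<open>\<epsilon>\<close> is so small that the loss B \<epsilon> = m \<eta> / 8 is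
  affordable.\<close>

lemma velocity_estimate:
  assumes t: "0 \<le> t" and odd: "\<And>y. P (- y) t = - P y t" and even: "\<And>y. \<rho> (- y) t = \<rho> y t"
    and nonneg: "\<And>y. 0 \<le> \<rho> y t" and le: "\<And>y. \<rho> y t \<le> B"
    and diff2: "\<And>x h. 0 \<le> x \<Longrightarrow> x \<le> 1/2 \<Longrightarrow> 0 \<le> h \<Longrightarrow> h \<le> 1/2 \<Longrightarrow> 0 \<le> P (x + h) t + P (x - h) t - 2 * P x t"
    and m: "P 1 t = m" "0 < m" "m \<le> B"
    and x: "0 \<le> x" "x \<le> 1/4" and half: "\<rho> x t \<le> m / 2"
    and \<eta>: "\<eta> = m / (8 * B)" and \<epsilon>: "\<epsilon> = m * \<eta> / (8 * B)"
  shows "u x t \<le> - (a * (m * \<eta> / 8) * \<epsilon>) * x"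
proof -
  note mono = \<rho>_mono[OF t diff2]
  have B: "0 < B" using m by simp
  have \<eta>_pos: "0 < \<eta>" and \<eta>_le: "\<eta> \<le> 1/8" using m B by (auto simp: \<eta> field_simps)
  have B\<eta>: "B * \<eta> = m / 8" and B\<epsilon>: "B * \<epsilon> = m * \<eta> / 8" using B by (auto simp: \<eta> \<epsilon>)
  have \<epsilon>_pos: "0 < \<epsilon>" using \<eta>_pos m B by (simp add: \<epsilon>)
  have "\<epsilon> = \<eta> * \<eta>" using B by (simp add: \<eta> \<epsilon> field_simps)
  then have \<epsilon>_le: "\<epsilon> \<le> \<eta> / 8" using \<eta>_pos mult_left_mono[OF \<eta>_le, of \<eta>] by simp
  have P_half: "P (1/2) t = m / 2"
    using P_shift[OF t, of "- (1/2)"] odd[of "1/2"] m(1) by simp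
  define E where "E z = P (x + z) t + P (x - z) t - 2 * P x t" for z
  have E_deriv: "(E has_real_derivative \<rho> (x + z) t - \<rho> (x - z) t) (at z)" for z
    unfolding E_def by (auto intro!: derivative_eq_intros DERIV_chain2[OF P_deriv[OF t]])
  have fold: "\<rho> (x - z) t \<le> \<rho> (x + z) t" if "0 \<le> z" "z \<le> 1/2" for z
    using x that by (intro even_periodic_fold_le[of "\<lambda>y. \<rho> y t"] even \<rho>_periodic mono t) auto
  have E_mono: "E z \<le> E w" if "0 \<le> z" "z \<le> w" "w \<le> 1/2" for z w
  proof (rule DERIV_nonneg_imp_nondecreasing[OF \<open>z \<le> w\<close>])
    fix y assume "z \<le> y" "y \<le> w"
    then show "\<exists>d. (E has_real_derivative d) (at y) \<and> 0 \<le> d"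
      using E_deriv[of y] fold[of y] that
      by (intro exI[of _ "\<rho> (x + y) t - \<rho> (x - y) t"]) auto
  qed
  have E_per: "E (z + 1) = E z" for z
  proof -
    have "P (x + (z + 1)) t = P (x + z) t + P 1 t"
      using P_shift[OF t, of "x + z"] by (simp add: add.assoc)
    moreover have "x - (z + 1) + 1 = x - z" by simp
    then have "P (x - z) t = P (x - (z + 1)) t + P 1 t"
      using P_shift[OF t, of "x - (z + 1)"] by metis
    ultimately show ?thesis by (simp add: E_def)
  qed
  have E_refl: "E (1 - z) = E z" for z
  proof -
    have "x - z + 1 = x + (1 - z)" "x - (1 - z) + 1 = x + z" by simp_all
    then have "P (x + (1 - z)) t = P (x - z) t + P 1 t" "P (x + z) t = P (x - (1 - z)) t + P 1 t"
      using P_shift[OF t] by metis+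
    then show ?thesis by (simp add: E_def)
  qed
  have E_nonneg: "0 \<le> E z" for z
  proof -
    define w where "w = (if frac z \<le> 1/2 then frac z else 1 - frac z)"
    have "E z = E w" using periodic_frac[of E z, OF E_per] E_refl[of "frac z"] by (simp add: w_def)
    moreover have "0 \<le> w" "w \<le> 1/2" using frac_lt_1[of z] frac_ge_0[of z] by (auto simp: w_def)
    ultimately show ?thesis using diff2[of x w] x by (simp add: E_def)
  qed
  have low: "\<rho> y t \<le> m / 2" if "0 \<le> y" "y \<le> x" for y
    using mono[of y x] that x half by auto
  \<comment> \<open>Otherwise monotonicity leaves less than 3m/8 on [0, w], while [w, 1/2] holds at
    most B \<eta> = m/8; together this is less than the mass m/2 of half a period.\<close>
  have high: "3 * m / 4 \<le> \<rho> y t" if y: "1/2 - \<eta> \<le> y" "y \<le> 1/2 + \<eta>" for y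
  proof -
    define w where "w = (if y \<le> 1/2 then y else 1 - y)"
    have w: "1/2 - \<eta> \<le> w" "w \<le> 1/2" using y by (auto simp: w_def)
    have "\<rho> y t = \<rho> w t"
      using even[of y] \<rho>_periodic[OF t, of "- y"] by (simp add: w_def)
    moreover have "3 * m / 4 \<le> \<rho> w t"
    proof (rule ccontr)
      assume "\<not> 3 * m / 4 \<le> \<rho> w t"
      then have "\<rho> w t * w < 3 * m / 4 * w" using w \<eta>_le by (intro mult_strict_right_mono) auto
      also have "\<dots> \<le> 3 * m / 4 * (1/2)" using w m by (intro mult_left_mono) auto
      finally have "\<rho> w t * w < 3 * m / 8" by simp
      moreover have "P w t - P 0 t \<le> \<rho> w t * (w - 0)"
        using w \<eta>_le by (intro P_increment_le t mono) auto
      moreover have "P (1/2) t - P w t \<le> B * (1/2 - w)"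
        using w by (intro P_increment_le t le) auto
      moreover have "B * (1/2 - w) \<le> B * \<eta>" using w B by (intro mult_left_mono) auto
      ultimately show False using P_half P_0 B\<eta> by simp
    qed
    ultimately show ?thesis by simp
  qed
  define b where "b = 1/2 - \<epsilon>"
  have b: "0 < b" "b \<le> 1/2" using \<epsilon>_le \<epsilon>_pos \<eta>_le by (auto simp: b_def)
  have "P x t - P 0 t \<le> m / 2 * (x - 0)"
    using x by (intro P_increment_le t low) auto
  then have P_x: "P x t \<le> m * x / 2" using P_0 by simp
  have E_b: "m * \<eta> / 8 * x \<le> E b"
  proof (cases "x \<le> \<eta> / 2")
    \<comment> \<open>For small x the interval [b - x, b + x] lies in the dense window; its mass, at
      least 3 m x / 2, outweighs the mass of [-x, x], at most m x.\<close>
    case True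
    have "3 * m / 4 * ((b + x) - (b - x)) \<le> P (b + x) t - P (b - x) t"
      using True \<epsilon>_le \<eta>_pos \<epsilon>_pos x by (intro P_increment_ge t high) (auto simp: b_def)
    then have "3 * m / 2 * x \<le> E b + 2 * P x t"
      using odd[of "b - x"] by (simp add: E_def add.commute)
    moreover have "0 \<le> m * x" using m x by simp
    moreover have "\<eta> * (m * x) \<le> 1 * (m * x)"
      using \<eta>_le m x by (intro mult_right_mono) auto
    ultimately show ?thesis using P_x by (simp add: algebra_simps)
  next
    case False
    \<comment> \<open>The mass of [1/2 - w, 1/2] minus that of [0, w]. It is nondecreasing for w
      \<le> 1/4 by monotonicity of the density, and at \<eta>/2 it is at least (3m/4 - m/2) \<eta>/2
      = m \<eta> / 8.\<close>
    define g where "g w = m / 2 - P (1/2 - w) t - P w t" for w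
    have g_deriv: "(g has_real_derivative \<rho> (1/2 - w) t - \<rho> w t) (at w)" for w
      unfolding g_def by (auto intro!: derivative_eq_intros DERIV_chain2[OF P_deriv[OF t]])
    have \<eta>_x: "\<eta> / 2 \<le> x" using False by simp
    have "g (\<eta> / 2) \<le> g x"
    proof (rule DERIV_nonneg_imp_nondecreasing[OF \<eta>_x])
      fix w assume "\<eta> / 2 \<le> w" "w \<le> x"
      then show "\<exists>d. (g has_real_derivative d) (at w) \<and> 0 \<le> d"
        using g_deriv[of w] mono[of w "1/2 - w"] x \<eta>_pos
        by (intro exI[of _ "\<rho> (1/2 - w) t - \<rho> w t"]) auto
    qed
    moreover have "3 * m / 4 * (1/2 - (1/2 - \<eta> / 2)) \<le> P (1/2) t - P (1/2 - \<eta> / 2) t"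
      using \<eta>_pos by (intro P_increment_ge t high) auto
    moreover have "P (\<eta> / 2) t - P 0 t \<le> m / 2 * (\<eta> / 2 - 0)"
      using False \<eta>_pos by (intro P_increment_le t low) auto
    ultimately have "m * \<eta> / 8 \<le> g x" using P_half P_0 by (simp add: g_def)
    moreover have "E (1/2) = 2 * g x"
      using P_shift[OF t, of "x - 1/2"] odd[of "1/2 - x"] m(1)
      by (simp add: E_def g_def add.commute)
    \<comment> \<open>Going back from 1/2 to b costs at most m \<eta> / 8, half of the lower bound 2
      (m \<eta> / 8) for \<open>E (1/2)\<close>.\<close>
    moreover have "E (1/2) - E b \<le> B * \<epsilon>"
    proof -
      have "P (x + 1/2) t - P (x + b) t \<le> B * ((x + 1/2) - (x + b))"
        using b by (intro P_increment_le t le) auto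
      moreover have "0 * ((x - b) - (x - 1/2)) \<le> P (x - b) t - P (x - 1/2) t"
        using b by (intro P_increment_ge t nonneg) auto
      ultimately show ?thesis by (simp add: E_def b_def)
    qed
    moreover have "m * \<eta> / 8 * x \<le> m * \<eta> / 8 * 1"
      using m \<eta>_pos x by (intro mult_left_mono) auto
    ultimately show ?thesis using B\<epsilon> by simp
  qed
  have "u x t \<le> - (a * (m * \<eta> / 8 * x) * (1/2 - b))"
  proof (rule pv_lim_by_parts[OF a_pos a_less u_lim[OF t, of x], where Q = "\<lambda>z. - E z"])
    show "((\<lambda>z. - E z) has_real_derivative \<rho> (x - z) t - \<rho> (x + z) t) (at z)" for z
      by (auto intro!: derivative_eq_intros DERIV_chain2[OF E_deriv])
    show "continuous_on UNIV (\<lambda>z. \<rho> (x - z) t - \<rho> (x + z) t)"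
      using t by (intro continuous_intros \<rho>_cont_comp)
    have "(\<lambda>z. \<rho> (x + s * z) t) differentiable (at 0)" for s
      using \<rho>_differentiable[OF t] differentiable_chain_at[of "\<lambda>z. x + s * z" 0 "\<lambda>y. \<rho> y t"]
      by (simp add: comp_def)
    note diff = this[where s = 1, simplified] this[where s = "-1", simplified]
    show "(\<lambda>z. \<rho> (x - z) t - \<rho> (x + z) t) differentiable (at 0)"
      by (intro derivative_intros diff)
    show "- E z \<le> - (m * \<eta> / 8 * x)" if "b \<le> z" "z \<le> 1/2" for z
      using E_b E_mono[of b z] b that by simp
  qed (use E_nonneg b m \<eta>_pos x in \<open>auto simp: E_def\<close>)
  then show ?thesis by (simp add: b_def algebra_simps)
qed

end

section \<open>Transfer of the velocity estimate to classical solutions\<close>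

theorem theorem3p1:
  fixes a m rmax :: real
  assumes "0 < a" "a < 2" "0 < m" "0 < rmax"
  shows "\<exists>A>0. \<forall>rho0 rho u.
           admissible_datum rmax rho0 \<and> integral {-1/2..1/2} rho0 = m \<and>
           classical_solution a rho0 rho u \<longrightarrow>
           (\<forall>x t. 0 \<le> x \<and> x \<le> delta_const a \<and> 0 \<le> t \<and> rho x t \<le> m / 2 \<longrightarrow>
                  u x t \<le> - A * x)"
proof -
  \<comment> \<open>\<open>B\<close> is the bound of \<open>\<rho>_le\<close>, valid at all times,
    so \<open>A\<close> depends on \<open>a\<close>, \<open>m\<close> and \<open>rmax\<close> alone.
    The factor \<open>c_alpha a\<close> in \<open>A\<close> undoes the normalisation of the velocity
    in the locale.\<close>
  define B where "B = m + rmax"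
  define \<eta> where "\<eta> = m / (8 * B)"
  define \<epsilon> where "\<epsilon> = m * \<eta> / (8 * B)"
  define A where "A = c_alpha a * (a * (m * \<eta> / 8) * \<epsilon>)"
  have c: "0 < c_alpha a" using assms by (intro c_alpha_pos)
  have "0 < B" "m \<le> B" using assms by (auto simp: B_def)
  then have "0 < A" using assms c by (simp add: A_def \<eta>_def \<epsilon>_def)
  moreover have "u x t \<le> - A * x"
    if datum: "admissible_datum rmax rho0" and mass: "integral {-1/2..1/2} rho0 = m"
      and sol: "classical_solution a rho0 rho u"
      and x: "0 \<le> x" "x \<le> delta_const a" and t: "0 \<le> t" and half: "rho x t \<le> m / 2"
    for rho0 rho u x t
  proof -
    from datum have smooth: "smooth_real rho0" and even0: "\<And>x. rho0 (- x) = rho0 x"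
      and bounds0: "\<And>x. 0 \<le> rho0 x" "\<And>x. rho0 x \<le> rmax"
      and deriv0: "\<And>x. 0 \<le> x \<Longrightarrow> x \<le> 1/2 \<Longrightarrow> 0 \<le> deriv rho0 x"
      by (auto simp: admissible_datum_def)
    obtain P where "transport a (c_alpha a) P rho (\<lambda>x t. u x t / c_alpha a)"
      using classical_solution_transport[OF assms(1,2) sol smooth] .
    then interpret transport a "c_alpha a" P rho "\<lambda>x t. u x t / c_alpha a" .
    have rho_0: "rho x 0 = rho0 x" for x using sol by (simp add: classical_solution_def)
    have "(rho0 has_real_derivative deriv rho0 y) (at y)" for y
      using spec[OF spec[OF smooth[unfolded smooth_real_def], of 0], of y]
      by (simp add: DERIV_deriv_iff_real_differentiable)
    then have mono0: "rho0 p \<le> rho0 q" if "0 \<le> p" "p \<le> q" "q \<le> 1/2" for p q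
      using that deriv0 by (intro DERIV_nonneg_imp_nondecreasing[OF \<open>p \<le> q\<close>]) force
    \<comment> \<open>The mass is prescribed on the centred period; \<open>P_shift\<close>
      identifies it with \<open>P 1 0\<close>.\<close>
    have "(rho0 has_integral P (1/2) 0 - P (-1/2) 0) {-1/2..1/2}"
    proof (rule fundamental_theorem_of_calculus)
      show "((\<lambda>y. P y 0) has_vector_derivative rho0 y) (at y within {-1/2..1/2})" for y
        using has_field_derivative_at_within[OF P_deriv[of 0 y]]
        by (simp add: has_real_derivative_iff_has_vector_derivative[symmetric] rho_0)
    qed simp
    then have P1: "P 1 0 = m" using P_shift[of 0 "-1/2"] mass by (simp add: integral_unique)
    have nonneg: "0 \<le> rho y s" if "0 \<le> s" for y s
      by (rule \<rho>_nonneg) (use that assms(3) in \<open>auto simp: P1 rho_0 bounds0\<close>)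
    have even0': "rho (- y) 0 = rho y 0" for y by (simp add: rho_0 even0)
    have "rho y t \<le> P 1 0 + rmax" for y
      by (rule \<rho>_le) (use nonneg t in \<open>auto simp: rho_0 bounds0\<close>)
    then have "rho y t \<le> B" for y by (simp add: P1 B_def)
    moreover have "0 \<le> P (y + h) t + P (y - h) t - 2 * P y t"
      if "0 \<le> y" "y \<le> 1/2" "0 \<le> h" "h \<le> 1/2" for y h
      using that mono0 by (intro second_difference_nonneg nonneg even0' t) (auto simp: rho_0)
    moreover have "rho (- y) t = rho y t" "P (- y) t = - P y t" for y
      by (rule \<rho>_even; use nonneg even0' t in auto)+
    moreover have "x \<le> 1/4" using x by (simp add: delta_const_def)
    ultimately have "u x t / c_alpha a \<le> - (a * (m * \<eta> / 8) * \<epsilon>) * x"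
      using nonneg[OF t] mass_conserved[OF t] P1 assms(3) \<open>m \<le> B\<close>
        x(1) half \<eta>_def \<epsilon>_def
      by (intro velocity_estimate[where B = B] t) auto
    then show ?thesis using c by (simp add: A_def field_simps)
  qed
  ultimately show ?thesis by blast
qed

end
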